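(* Suppose $n\delta_n\to+\infty$ as $n\to+\infty$, and put $\varphi_n=\sqrt{\delta_n/n}$. For $\theta\in\Theta$ let $F(\theta)=r\ln\Bigl(\frac{\psi(\theta)+r}{\psi(\theta)}\Bigr)$. Then, for all $\theta_0\in\Theta$, \[ \lim_{\epsilon\to0}\ \liminf_{n\to+\infty}\ \inf_{\bar\theta_n}\ \sup_{|\theta-\theta_0|<\epsilon}\varphi_n^{-2}\,\mathbf{E}_\theta\bigl(\bar\theta_n-\theta\bigr)^2\ \geq\ \frac1{F(\theta_0)}, \] where the infimum is taken over all possible estimators $\bar\theta_n$ of the parameter $\theta$ (measurable functions of the observations $X^{(n)}$).
   Context: Let $0<\alpha<\beta<\tau$ be known constants, $\psi$ a known strictly positive continuous function on $[0,\tau]$, $r>-\min_{0\le t\le\tau}\psi(t)$ a known constant with $r\neq0$, and $(\delta_n)$ a known sequence of positive numbers decreasing to $0$. The unknown parameter is $\theta\in\Theta=(\alpha,\beta)$. For each $n\ge1$ one observes $X^{(n)}=(X_1,\ldots,X_n)$, where $X_j=(X_j(t),\ 0\le t\le\tau)$, $j=1,\ldots,n$, are independent inhomogeneous Poisson processes on $[0,\tau]$ with common intensity function \[ \lambda_\theta^{(n)}(t)=\psi(t)+\frac{r}{\delta_n}(t-\theta)\,\mathbb{1}_{[\theta,\theta+\delta_n)}(t)+r\,\mathbb{1}_{[\theta+\delta_n,\tau]}(t),\qquad 0\le t\le\tau. \] $\mathbf{P}_\theta=\mathbf{P}_\theta^{(n)}$ denotes the law of $X^{(n)}$ and $\mathbf{E}_\theta=\mathbf{E}_\theta^{(n)}$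 the corresponding expectation. *)

theory Defs
  imports "HOL-Probability.Probability"
begin

definition counting_paths :: "real \<Rightarrow> (real \<Rightarrow> nat) set" where
  "counting_paths \<tau> =
     {x. x 0 = 0 \<and> mono_on {0..\<tau>} x \<and> (\<forall>t\<in>{0..\<tau>}. continuous (at t within {t..\<tau>}) x)}"

text \<open>
  Since a path is a function on \<open>[0,\<tau>]\<close> only, it is \<open>undefined\<close> outside this interval, as
  required by the product space.
\<close>

definition path_space :: "real \<Rightarrow> (real \<Rightarrow> nat) measure" where
  "path_space \<tau> = restrict_space (PiM {0..\<tau>} (\<lambda>_. count_space UNIV)) (counting_paths \<tau>)"

text \<open>
  The Poisson probabilities are written out because \<open>poisson_pmf\<close> needs a positive rate, whereas
  a general intensity may vanish on an interval.  Natural subtraction does not truncate in the increments below, because the paths are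
  nondecreasing.
\<close>

locale poisson_process = prob_space M
  for M :: "'a measure" and \<tau> :: real and lam :: "real \<Rightarrow> real" and X :: "'a \<Rightarrow> real \<Rightarrow> nat" +
  assumes intensity_nonneg: "\<And>t. t \<in> {0..\<tau>} \<Longrightarrow> 0 \<le> lam t"
    and intensity_integrable: "set_integrable lborel {0..\<tau>} lam"
    and measurable_path: "X \<in> M \<rightarrow>\<^sub>M path_space \<tau>"
    and poisson_increments:
      "\<And>s t k. 0 \<le> s \<Longrightarrow> s < t \<Longrightarrow> t \<le> \<tau> \<Longrightarrow>
         prob {\<omega> \<in> space M. X \<omega> t - X \<omega> s = k} =
           (LBINT u:{s..t}. lam u) ^ k / fact k * exp (- (LBINT u:{s..t}. lam u))"
    and independent_increments:
      "\<And>(k::nat) (t :: nat \<Rightarrow> real). mono_on {..k} t \<Longrightarrow> 0 \<le> t 0 \<Longrightarrow> t k \<le> \<tau> \<Longrightarrow>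
         indep_vars (\<lambda>_. count_space UNIV) (\<lambda>i \<omega>. X \<omega> (t (Suc i)) - X \<omega> (t i)) {..<k}"

definition poisson_sample ::
    "'a measure \<Rightarrow> real \<Rightarrow> (real \<Rightarrow> real) \<Rightarrow> nat \<Rightarrow> (nat \<Rightarrow> 'a \<Rightarrow> real \<Rightarrow> nat) \<Rightarrow> bool" where
  "poisson_sample M \<tau> lam n X \<longleftrightarrow>
     (\<forall>j\<in>{1..n}. poisson_process M \<tau> lam (X j)) \<and>
     prob_space.indep_vars M (\<lambda>_. path_space \<tau>) X {1..n}"

definition sample_space :: "real \<Rightarrow> nat \<Rightarrow> (nat \<Rightarrow> real \<Rightarrow> nat) measure" where
  "sample_space \<tau> n = PiM {1..n} (\<lambda>_. path_space \<tau>)"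

definition sample_law ::
    "'a measure \<Rightarrow> real \<Rightarrow> nat \<Rightarrow> (nat \<Rightarrow> 'a \<Rightarrow> real \<Rightarrow> nat) \<Rightarrow> (nat \<Rightarrow> real \<Rightarrow> nat) measure" where
  "sample_law M \<tau> n X = distr M (sample_space \<tau> n) (\<lambda>\<omega>. \<lambda>j\<in>{1..n}. X j \<omega>)"

definition intensity ::
    "(real \<Rightarrow> real) \<Rightarrow> real \<Rightarrow> real \<Rightarrow> real \<Rightarrow> real \<Rightarrow> real \<Rightarrow> real" where
  "intensity \<psi> r \<tau> d \<theta> t =
     \<psi> t + r / d * (t - \<theta>) * indicator {\<theta>..<\<theta> + d} t + r * indicator {\<theta> + d..\<tau>} t"

text \<open>
  The quadratic risk is a nonnegative, possibly infinite, integral, so that estimators without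
  second moment are admitted with risk \<open>\<infinity>\<close>.
\<close>

definition quadratic_risk ::
    "(nat \<Rightarrow> real \<Rightarrow> nat) measure \<Rightarrow> real \<Rightarrow> ((nat \<Rightarrow> real \<Rightarrow> nat) \<Rightarrow> real) \<Rightarrow> ennreal" where
  "quadratic_risk P \<theta> T = (\<integral>\<^sup>+ x. ennreal ((T x - \<theta>)\<^sup>2) \<partial>P)"

end

theory Submission
  imports Defs "HOL-Real_Asymp.Real_Asymp"
begin

text \<open>
  An estimator of small risk has small bias, and so its expectation has to follow the parameter.
  Its expectation can change from one parameter to the next only as fast as the laws of the
  observations do.  Playing these two facts off against each other over a range of parameters that is
  long compared with \<open>\<phi> n\<close> gives the bound.

  In detail, take the points \<open>\<theta>\<^sub>0 + k * u\<close> for \<open>k = 0, ..., N\<close> with \<open>u = h * \<phi> n\<close>, and let the risk at each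
  of them be at most \<open>R\<close>.  The bias at the two ends is at most \<open>sqrt R\<close>.  Between neighbours, the
  Hammersley-Chapman-Robbins inequality bounds the change of the expectation by
  \<open>sqrt R * sqrt (c - 1)\<close>, where \<open>c\<close> is the second moment of the likelihood ratio of neighbouring laws.
  So \<open>N * u \<le> sqrt R * (2 + N * sqrt (c - 1))\<close> (\<open>bias_telescoping_bound\<close>).  For Poisson processes with
  intensities \<open>\<lambda>'\<close> and \<open>\<lambda>\<close> the second moment is at most the exponential of \<open>n\<close> times the integral of
  \<open>(\<lambda>' - \<lambda>)\<^sup>2 / \<lambda>\<close>, and for the intensities at hand this exponent is asymptotically at most
  \<open>h\<^sup>2 * F \<theta>\<^sub>0\<close> (\<open>intensity_chi_square_bound\<close>): the two intensities differ by about \<open>\<bar>r\<bar> * u / \<delta> n\<close> on the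
  ramp \<open>[\<theta>, \<theta> + \<delta> n]\<close>, and the integral of \<open>r\<^sup>2 / \<lambda>\<close> over the ramp is about \<open>\<delta> n * F \<theta>\<close>.  Letting \<open>n\<close>
  tend to infinity, then \<open>N\<close> to infinity and \<open>h\<close> to \<open>0\<close>, leaves \<open>R / (\<phi> n)\<^sup>2 \<ge> 1 / F \<theta>\<^sub>0\<close>.

  Two neighbouring laws are compared on finite grids first.  For the increments over a grid the
  second moment is a computation with products of Poisson distributions, and the resulting bound
  does not depend on the grid.  The \<open>\<sigma>\<close>-algebras of the grids are directed and generate
  that of the sample space, so the inequality extends to all bounded statistics by approximation
  (\<open>expectation_diff_extends_from_directed_subalgebras\<close>, \<open>sample_law_expectation_diff\<close>).
\<close>

section \<open>Densities with a bounded second moment\<close>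

text \<open>
  The bound says that the chi-square divergence of \<open>Q\<close> from \<open>P\<close> is at most \<open>c - 1\<close>.  The second
  moment \<open>c\<close> is the better parameter because it is multiplicative over products.
\<close>

definition second_moment_le :: "real \<Rightarrow> 'a measure \<Rightarrow> 'a measure \<Rightarrow> bool" where
  "second_moment_le c P Q \<longleftrightarrow>
     (\<exists>\<rho>\<in>borel_measurable P. (\<forall>x. 0 \<le> \<rho> x) \<and> Q = density P (\<lambda>x. ennreal (\<rho> x)) \<and>
        (\<integral>\<^sup>+x. ennreal ((\<rho> x)\<^sup>2) \<partial>P) \<le> ennreal c)"

lemma second_moment_le_PiM:
  assumes I: "finite I" and P: "\<And>i. prob_space (P i)" and Q: "\<And>i. prob_space (Q i)"
    and c: "\<And>i. i \<in> I \<Longrightarrow> 0 \<le> c i"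
    and *: "\<And>i. i \<in> I \<Longrightarrow> second_moment_le (c i) (P i) (Q i)"
  shows "second_moment_le (\<Prod>i\<in>I. c i) (PiM I P) (PiM I Q)"
proof -
  interpret P: product_prob_space P I by (rule product_prob_spaceI) (rule P)
  interpret Q: product_prob_space Q I by (rule product_prob_spaceI) (rule Q)
  from * obtain \<rho> where \<rho>: "\<And>i. i \<in> I \<Longrightarrow> \<rho> i \<in> borel_measurable (P i)"
      "\<And>i x. i \<in> I \<Longrightarrow> 0 \<le> \<rho> i x" "\<And>i. i \<in> I \<Longrightarrow> Q i = density (P i) (\<lambda>x. ennreal (\<rho> i x))"
      "\<And>i. i \<in> I \<Longrightarrow> (\<integral>\<^sup>+x. ennreal ((\<rho> i x)\<^sup>2) \<partial>P i) \<le> ennreal (c i)"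
    unfolding second_moment_le_def by metis
  note [measurable] = \<rho>(1)
  let ?\<rho> = "\<lambda>x. \<Prod>i\<in>I. \<bar>\<rho> i (x i)\<bar>"
  have sets_eq: "sets (Q i) = sets (P i)" if "i \<in> I" for i
    using \<rho>(3)[OF that] by (metis sets_density)
  have m: "?\<rho> \<in> borel_measurable (PiM I P)"
    by measurable
  have "density (PiM I P) (\<lambda>x. ennreal (?\<rho> x)) = PiM I Q"
  proof (rule Q.PiM_eqI[OF I])
    show "sets (density (PiM I P) (\<lambda>x. ennreal (?\<rho> x))) = sets (PiM I Q)"
      by (simp add: sets_eq cong: sets_PiM_cong)
    fix A assume A: "\<And>i. i \<in> I \<Longrightarrow> A i \<in> sets (Q i)"
    then have A': "\<And>i. i \<in> I \<Longrightarrow> A i \<in> sets (P i)" by (simp add: sets_eq)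
    have "emeasure (density (PiM I P) (\<lambda>x. ennreal (?\<rho> x))) (Pi\<^sub>E I A) =
        (\<integral>\<^sup>+x. ennreal (?\<rho> x) * indicator (Pi\<^sub>E I A) x \<partial>PiM I P)"
      using m A' I by (intro emeasure_density) auto
    also have "\<dots> = (\<integral>\<^sup>+x. (\<Prod>i\<in>I. ennreal (\<rho> i (x i)) * indicator (A i) (x i)) \<partial>PiM I P)"
    proof (rule nn_integral_cong)
      fix x assume x: "x \<in> space (PiM I P)"
      then have "indicator (Pi\<^sub>E I A) x = (\<Prod>i\<in>I. indicator (A i) (x i) :: ennreal)"
        using I by (auto simp: indicator_def space_PiM PiE_iff prod.neutral intro!: prod_zero[symmetric] bexI)
      then show "ennreal (?\<rho> x) * indicator (Pi\<^sub>E I A) x =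
          (\<Prod>i\<in>I. ennreal (\<rho> i (x i)) * indicator (A i) (x i))"
        using \<rho>(2) by (simp add: prod.distrib flip: prod_ennreal)
    qed
    also have "\<dots> = (\<Prod>i\<in>I. \<integral>\<^sup>+x. ennreal (\<rho> i x) * indicator (A i) x \<partial>P i)"
      using A' by (intro P.product_nn_integral_prod I) auto
    also have "\<dots> = (\<Prod>i\<in>I. emeasure (Q i) (A i))"
      using A' by (intro prod.cong refl) (auto simp: \<rho>(3) emeasure_density)
    finally show "emeasure (density (PiM I P) (\<lambda>x. ennreal (?\<rho> x))) (Pi\<^sub>E I A) =
      (\<Prod>i\<in>I. emeasure (Q i) (A i))" .
  qed
  moreover have "(\<integral>\<^sup>+x. ennreal ((?\<rho> x)\<^sup>2) \<partial>PiM I P) \<le> ennreal (\<Prod>i\<in>I. c i)"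
  proof -
    have "(\<integral>\<^sup>+x. ennreal ((?\<rho> x)\<^sup>2) \<partial>PiM I P) =
        (\<integral>\<^sup>+x. (\<Prod>i\<in>I. ennreal ((\<rho> i (x i))\<^sup>2)) \<partial>PiM I P)"
      by (simp add: prod_ennreal prod_power_distrib)
    also have "\<dots> = (\<Prod>i\<in>I. \<integral>\<^sup>+x. ennreal ((\<rho> i x)\<^sup>2) \<partial>P i)"
      by (intro P.product_nn_integral_prod I) measurable
    also have "\<dots> \<le> (\<Prod>i\<in>I. ennreal (c i))"
      by (intro prod_mono_ennreal) (rule \<rho>(4))
    finally show ?thesis by (simp add: c prod_ennreal)
  qed
  ultimately show ?thesis
    unfolding second_moment_le_def using m by (intro bexI[of _ ?\<rho>]) (auto intro: prod_nonneg)
qed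

text \<open>
  A density between the laws of a statistic \<open>\<pi>\<close>, composed with \<open>\<pi>\<close>, is a density between the
  restrictions of \<open>P\<close> and \<open>Q\<close> to the \<open>\<sigma>\<close>-algebra generated by \<open>\<pi>\<close>.  Pushing a measure forward along the
  identity into that smaller \<open>\<sigma>\<close>-algebra is what restricts it.
\<close>

lemma second_moment_le_vimage_algebra:
  assumes [measurable]: "\<pi> \<in> measurable P N" and sets: "sets Q = sets P"
    and *: "second_moment_le c (distr P N \<pi>) (distr Q N \<pi>)"
  defines "G \<equiv> vimage_algebra (space P) \<pi> N"
  shows "second_moment_le c (distr P G (\<lambda>x. x)) (distr Q G (\<lambda>x. x))"
proof -
  have sp: "space Q = space P" using sets by (rule sets_eq_imp_space_eq)
  have \<pi>Q[measurable]: "\<pi> \<in> measurable Q N" using assms(1) sets by simp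
  have id[measurable]: "(\<lambda>x. x) \<in> measurable P G" "(\<lambda>x. x) \<in> measurable Q G"
    unfolding G_def by (auto intro!: measurable_vimage_algebra2 simp: sp)
  have \<pi>G[measurable]: "\<pi> \<in> measurable G N"
    unfolding G_def by (intro measurable_vimage_algebra1) (auto intro: measurable_space[OF assms(1)])
  from * obtain \<rho> where [measurable]: "\<rho> \<in> borel_measurable N" and \<rho>: "\<And>x. 0 \<le> \<rho> x"
      "distr Q N \<pi> = density (distr P N \<pi>) (\<lambda>x. ennreal (\<rho> x))"
      "(\<integral>\<^sup>+x. ennreal ((\<rho> x)\<^sup>2) \<partial>distr P N \<pi>) \<le> ennreal c"
    unfolding second_moment_le_def by auto
  have "distr Q G (\<lambda>x. x) = density (distr P G (\<lambda>x. x)) (\<lambda>x. ennreal (\<rho> (\<pi> x)))"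
  proof (rule measure_eqI)
    fix A assume "A \<in> sets (distr Q G (\<lambda>x. x))"
    then have AG[measurable]: "A \<in> sets G" by simp
    then obtain B where B[measurable]: "B \<in> sets N" and A: "A = \<pi> -` B \<inter> space P"
      unfolding G_def using sets_vimage_algebra2[of \<pi> "space P" N] measurable_space[OF assms(1)] by blast
    have "emeasure (distr Q G (\<lambda>x. x)) A = emeasure Q (A \<inter> space Q)"
      by (simp add: emeasure_distr)
    also have "\<dots> = emeasure (distr Q N \<pi>) B"
      by (subst emeasure_distr) (auto simp: A sp intro!: arg_cong[where f="emeasure Q"])
    also have "\<dots> = (\<integral>\<^sup>+x. ennreal (\<rho> (\<pi> x)) * indicator B (\<pi> x) \<partial>P)"
      by (simp add: \<rho>(2) emeasure_density nn_integral_distr)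
    also have "\<dots> = (\<integral>\<^sup>+x. ennreal (\<rho> (\<pi> x)) * indicator A x \<partial>P)"
      by (intro nn_integral_cong) (auto simp: A indicator_def)
    also have "\<dots> = emeasure (density (distr P G (\<lambda>x. x)) (\<lambda>x. ennreal (\<rho> (\<pi> x)))) A"
      by (simp add: emeasure_density nn_integral_distr)
    finally show "emeasure (distr Q G (\<lambda>x. x)) A =
      emeasure (density (distr P G (\<lambda>x. x)) (\<lambda>x. ennreal (\<rho> (\<pi> x)))) A" .
  qed simp
  moreover have "(\<integral>\<^sup>+x. ennreal ((\<rho> (\<pi> x))\<^sup>2) \<partial>distr P G (\<lambda>x. x)) \<le> ennreal c"
    using \<rho>(3) by (simp add: nn_integral_distr)
  ultimately show ?thesis
    unfolding second_moment_le_def using \<rho>(1) by (intro bexI[of _ "\<lambda>x. \<rho> (\<pi> x)"]) auto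
qed

text \<open>
  The Hammersley-Chapman-Robbins inequality.  With \<open>\<rho>\<close> the density, the difference of the two
  expectations is \<open>\<integral> (\<rho> - 1) f dP\<close>, and Cauchy-Schwarz applies because \<open>\<integral> (\<rho> - 1)\<^sup>2 dP = \<integral> \<rho>\<^sup>2 dP - 1\<close>.
\<close>

lemma second_moment_le_expectation_diff:
  fixes f :: "'a \<Rightarrow> real"
  assumes P: "prob_space P" and Q: "prob_space Q" and c: "0 \<le> c" and *: "second_moment_le c P Q"
    and f[measurable]: "f \<in> borel_measurable P" and bnd: "\<And>x. \<bar>f x\<bar> \<le> B"
  shows "\<bar>(\<integral>x. f x \<partial>Q) - (\<integral>x. f x \<partial>P)\<bar> \<le> sqrt (c - 1) * sqrt (\<integral>x. (f x)\<^sup>2 \<partial>P)"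
proof -
  interpret P: prob_space P by fact
  interpret Q: prob_space Q by fact
  from * obtain \<rho> where m[measurable]: "\<rho> \<in> borel_measurable P" and \<rho>: "\<And>x. 0 \<le> \<rho> x"
      "Q = density P (\<lambda>x. ennreal (\<rho> x))" "(\<integral>\<^sup>+x. ennreal ((\<rho> x)\<^sup>2) \<partial>P) \<le> ennreal c"
    unfolding second_moment_le_def by auto
  have i2: "integrable P (\<lambda>x. (\<rho> x)\<^sup>2)"
    using \<rho>(3) by (intro integrableI_bounded) (auto intro: le_less_trans)
  have i1: "integrable P \<rho>" by (rule P.square_integrable_imp_integrable[OF m i2])
  have "(\<integral>x. (\<rho> x)\<^sup>2 \<partial>P) \<le> c"
    using \<rho>(3) c i2 by (subst (asm) nn_integral_eq_integral) auto
  have "(\<integral>x. \<rho> x \<partial>P) = (\<integral>x. 1 \<partial>Q)"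
    unfolding \<rho>(2) by (subst integral_density) (auto simp: \<rho>(1))
  then have r1: "(\<integral>x. \<rho> x \<partial>P) = 1" by (simp add: Q.prob_space)
  have fi: "integrable P f" using bnd by (intro P.integrable_const_bound[of _ B]) auto
  have fi2: "integrable P (\<lambda>x. (f x)\<^sup>2)"
    using power_mono[OF bnd abs_ge_zero, where n = 2] by (intro P.integrable_const_bound[of _ "B\<^sup>2"]) auto
  have rf: "integrable P (\<lambda>x. \<rho> x * f x)"
  proof (rule Bochner_Integration.integrable_bound)
    show "integrable P (\<lambda>x. \<bar>B\<bar> * \<rho> x)" using i1 by simp
    show "AE x in P. norm (\<rho> x * f x) \<le> norm (\<bar>B\<bar> * \<rho> x)"
    proof (rule AE_I2)
      fix x
      have "\<bar>f x\<bar> * \<rho> x \<le> \<bar>B\<bar> * \<rho> x"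
        using bnd[of x] \<rho>(1)[of x] by (intro mult_right_mono) auto
      then show "norm (\<rho> x * f x) \<le> norm (\<bar>B\<bar> * \<rho> x)"
        using \<rho>(1)[of x] by (simp add: abs_mult mult.commute)
    qed
  qed simp
  have "(\<integral>x. f x \<partial>Q) = (\<integral>x. \<rho> x * f x \<partial>P)"
    unfolding \<rho>(2) by (subst integral_density) (auto simp: \<rho>(1))
  then have eq: "(\<integral>x. f x \<partial>Q) - (\<integral>x. f x \<partial>P) = (\<integral>x. (\<rho> x - 1) * f x \<partial>P)"
    using rf fi by (simp add: left_diff_distrib)
  have d2: "integrable P (\<lambda>x. (\<rho> x - 1)\<^sup>2)"
    using i1 i2 by (simp add: power2_diff)
  have var: "(\<integral>x. (\<rho> x - 1)\<^sup>2 \<partial>P) \<le> c - 1"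
    using i1 i2 r1 \<open>(\<integral>x. (\<rho> x)\<^sup>2 \<partial>P) \<le> c\<close> by (simp add: power2_diff P.prob_space)
  have prod_i: "integrable P (\<lambda>x. (\<rho> x - 1) * f x)"
    using rf fi by (simp add: left_diff_distrib)
  have "(\<integral>\<^sup>+x. ennreal \<bar>\<rho> x - 1\<bar> * ennreal \<bar>f x\<bar> \<partial>P)\<^sup>2 \<le>
      (\<integral>\<^sup>+x. (ennreal \<bar>\<rho> x - 1\<bar>)\<^sup>2 \<partial>P) * (\<integral>\<^sup>+x. (ennreal \<bar>f x\<bar>)\<^sup>2 \<partial>P)"
    by (rule Cauchy_Schwarz_nn_integral) auto
  also have "(\<integral>\<^sup>+x. (ennreal \<bar>\<rho> x - 1\<bar>)\<^sup>2 \<partial>P) = ennreal (\<integral>x. (\<rho> x - 1)\<^sup>2 \<partial>P)"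
    using d2 by (subst nn_integral_eq_integral[symmetric]) (auto simp: ennreal_power)
  also have "(\<integral>\<^sup>+x. (ennreal \<bar>f x\<bar>)\<^sup>2 \<partial>P) = ennreal (\<integral>x. (f x)\<^sup>2 \<partial>P)"
    using fi2 by (subst nn_integral_eq_integral[symmetric]) (auto simp: ennreal_power)
  also have "(\<integral>\<^sup>+x. ennreal \<bar>\<rho> x - 1\<bar> * ennreal \<bar>f x\<bar> \<partial>P) = ennreal (\<integral>x. \<bar>(\<rho> x - 1) * f x\<bar> \<partial>P)"
    using integrable_abs[OF prod_i]
    by (subst nn_integral_eq_integral[symmetric]) (auto simp: ennreal_mult abs_mult)
  finally have "(\<integral>x. \<bar>(\<rho> x - 1) * f x\<bar> \<partial>P)\<^sup>2 \<le> (\<integral>x. (\<rho> x - 1)\<^sup>2 \<partial>P) * (\<integral>x. (f x)\<^sup>2 \<partial>P)"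
    by (simp add: ennreal_power flip: ennreal_mult)
  also have "\<dots> \<le> (c - 1) * (\<integral>x. (f x)\<^sup>2 \<partial>P)"
    using var by (intro mult_right_mono) auto
  finally have "(\<integral>x. \<bar>(\<rho> x - 1) * f x\<bar> \<partial>P) \<le> sqrt ((c - 1) * (\<integral>x. (f x)\<^sup>2 \<partial>P))"
    by (rule real_le_rsqrt)
  moreover have "\<bar>\<integral>x. (\<rho> x - 1) * f x \<partial>P\<bar> \<le> (\<integral>x. \<bar>(\<rho> x - 1) * f x\<bar> \<partial>P)"
    by (rule integral_abs_bound)
  ultimately show ?thesis
    unfolding eq real_sqrt_mult by linarith
qed

section \<open>Approximation by a directed family of subalgebras\<close>

lemma finite_measure_dominating_two:
  assumes P: "finite_measure P" "sets P = sets M" and Q: "finite_measure Q" "sets Q = sets M"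
  obtains \<mu> where "finite_measure \<mu>" "sets \<mu> = sets M"
    "P \<le> \<mu>" "Q \<le> \<mu>"
proof
  interpret P: finite_measure P by (rule P)
  interpret Q: finite_measure Q by (rule Q)
  have eq: "sets Q = sets P" using P Q by simp
  let ?\<mu> = "sup_measure' P Q"
  show "sets ?\<mu> = sets M" using eq P by simp
  have "emeasure P A \<le> emeasure ?\<mu> A \<and> emeasure Q A \<le> emeasure ?\<mu> A" for A
  proof (cases "A \<in> sets P")
    case True
    then show ?thesis
      using eq by (auto intro: le_emeasure_sup_measure'1 le_emeasure_sup_measure'2)
  qed (simp add: eq emeasure_notin_sets)
  then show "P \<le> ?\<mu>" "Q \<le> ?\<mu>"
    using eq by (simp_all add: le_measure_iff le_fun_def sets_eq_imp_space_eq[OF eq])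
  have "emeasure ?\<mu> (space P) \<le> emeasure P (space P) + emeasure Q (space Q)"
    unfolding emeasure_sup_measure'[OF eq sets.top]
    by (intro SUP_least add_mono emeasure_space)
  also have "\<dots> < \<infinity>" by (simp add: less_top[symmetric])
  finally show "finite_measure ?\<mu>"
    using eq by (intro finite_measureI) (simp add: less_top)
qed

text \<open>
  The sets that can be approximated in measure by members of the subalgebras form a \<open>\<sigma>\<close>-algebra:
  complements do not change symmetric differences, and a countable union is approximated by a finite
  one, whose members have approximants in one common subalgebra by directedness.
\<close>

lemma approx_set_by_directed_subalgebras:
  fixes G :: "'i \<Rightarrow> 'a measure"
  assumes "finite_measure M"
    and G: "\<And>i. i \<in> I \<Longrightarrow> space (G i) = space M" "\<And>i. i \<in> I \<Longrightarrow> sets (G i) \<subseteq> sets M"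
    and directed: "\<And>i j. i \<in> I \<Longrightarrow> j \<in> I \<Longrightarrow> \<exists>k\<in>I. sets (G i) \<union> sets (G j) \<subseteq> sets (G k)"
    and "I \<noteq> {}"
    and gen: "sets M \<subseteq> sigma_sets (space M) (\<Union>i\<in>I. sets (G i))"
    and A: "A \<in> sets M" and "0 < (e::real)"
  shows "\<exists>i\<in>I. \<exists>B\<in>sets (G i). measure M (sym_diff A B) < e"
proof -
  interpret finite_measure M by fact
  have GM: "B \<in> sets M" if "B \<in> sets (G i)" "i \<in> I" for B i
    using G that by blast
  have "A \<in> sigma_sets (space M) (\<Union>i\<in>I. sets (G i))" using A gen by blast
  then have "A \<in> sets M \<and> (\<forall>e>0. \<exists>i\<in>I. \<exists>B\<in>sets (G i). measure M (sym_diff A B) < e)"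
    (is "_ \<and> (\<forall>e>0. ?approx A e)")
  proof (induction rule: sigma_sets.induct)
    case (Basic A)
    then obtain i where "i \<in> I" "A \<in> sets (G i)" by auto
    then show ?case using GM by (auto intro!: bexI[of _ i] bexI[of _ A])
  next
    case Empty
    from \<open>I \<noteq> {}\<close> obtain i where "i \<in> I" by auto
    then show ?case by (auto intro!: bexI[of _ i] bexI[of _ "{}"])
  next
    case (Compl A)
    show ?case
    proof (intro conjI allI impI)
      fix e :: real assume "e > 0"
      with Compl obtain i B where iB: "i \<in> I" "B \<in> sets (G i)" "measure M (sym_diff A B) < e" by blast
      have "sym_diff (space M - A) (space M - B) = sym_diff A B"
        using sets.sets_into_space[of A M] sets.sets_into_space[OF iB(2)] Compl G(1)[OF iB(1)] by auto
      moreover have "space M - B \<in> sets (G i)"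
        using sets.compl_sets[OF iB(2)] G(1)[OF iB(1)] by simp
      ultimately show "?approx (space M - A) e"
        using iB by (intro bexI[of _ i] bexI[of _ "space M - B"]) auto
    qed (use Compl in auto)
  next
    case (Union A)
    have AM: "A i \<in> sets M" for i using Union by auto
    show ?case
    proof (intro conjI allI impI)
      show "(\<Union>i. A i) \<in> sets M" using AM by auto
      fix e :: real assume e: "e > 0"
      define U where "U n = (\<Union>i\<le>n. A i)" for n
      have U: "U n \<in> sets M" for n unfolding U_def using AM by auto
      have "(\<lambda>n. measure M ((\<Union>i. A i) - U n)) \<longlonglongrightarrow> measure M (\<Inter>n. (\<Union>i. A i) - U n)"
        using AM U by (intro finite_Lim_measure_decseq) (auto simp: decseq_def U_def intro: order_trans)
      also have "(\<Inter>n. (\<Union>i. A i) - U n) = {}" by (auto simp: U_def)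
      finally have "\<forall>\<^sub>F n in sequentially. measure M ((\<Union>i. A i) - U n) < e/2"
        using e by (intro order_tendstoD) auto
      then obtain n where n: "measure M ((\<Union>i. A i) - U n) < e/2"
        by (auto dest: eventually_happens)
      have "?approx (U n) e'" if "e' > 0" for e'
        using that
      proof (induction n arbitrary: e')
        case 0
        then show ?case using Union.IH by (auto simp: U_def)
      next
        case (Suc n)
        obtain i B where iB: "i \<in> I" "B \<in> sets (G i)" "measure M (sym_diff (U n) B) < e'/2"
          using Suc.IH[of "e'/2"] Suc.prems by auto
        obtain j C where jC: "j \<in> I" "C \<in> sets (G j)" "measure M (sym_diff (A (Suc n)) C) < e'/2"
          using Union.IH[of "Suc n"] Suc.prems half_gt_zero by blast
        obtain k where k: "k \<in> I" "sets (G i) \<union> sets (G j) \<subseteq> sets (G k)"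
          using directed iB jC by blast
        have sub: "sym_diff (U (Suc n)) (B \<union> C) \<subseteq> sym_diff (U n) B \<union> sym_diff (A (Suc n)) C"
          by (auto simp: U_def atMost_Suc)
        have m: "sym_diff (U n) B \<in> sets M" "sym_diff (A (Suc n)) C \<in> sets M"
          using U AM GM iB jC by auto
        have "measure M (sym_diff (U (Suc n)) (B \<union> C)) < e'"
          using finite_measure_mono[OF sub] measure_Un_le[OF m] m iB jC by auto
        then show ?case using k iB jC by (intro bexI[of _ k] bexI[of _ "B \<union> C"]) auto
      qed
      from this[of "e/2"] e obtain i B where iB: "i \<in> I" "B \<in> sets (G i)"
          "measure M (sym_diff (U n) B) < e/2" by auto
      have sub: "sym_diff (\<Union>i. A i) B \<subseteq> ((\<Union>i. A i) - U n) \<union> sym_diff (U n) B"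
        by (auto simp: U_def)
      have m: "(\<Union>i. A i) - U n \<in> sets M" "sym_diff (U n) B \<in> sets M"
        using U AM GM iB by auto
      have "measure M (sym_diff (\<Union>i. A i) B) < e"
        using finite_measure_mono[OF sub] measure_Un_le[OF m] m iB n by auto
      then show "?approx (\<Union>i. A i) e" using iB by blast
    qed
  qed
  then show ?thesis using \<open>0 < e\<close> by blast
qed

lemma approx_integrable_by_directed_subalgebras:
  fixes G :: "'i \<Rightarrow> 'a measure" and f :: "'a \<Rightarrow> real"
  assumes "finite_measure M"
    and G: "\<And>i. i \<in> I \<Longrightarrow> space (G i) = space M" "\<And>i. i \<in> I \<Longrightarrow> sets (G i) \<subseteq> sets M"
    and directed: "\<And>i j. i \<in> I \<Longrightarrow> j \<in> I \<Longrightarrow> \<exists>k\<in>I. sets (G i) \<union> sets (G j) \<subseteq> sets (G k)"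
    and "I \<noteq> {}"
    and gen: "sets M \<subseteq> sigma_sets (space M) (\<Union>i\<in>I. sets (G i))"
    and f: "integrable M f" and "0 < e"
  shows "\<exists>i\<in>I. \<exists>g\<in>borel_measurable (G i). integrable M g \<and> (\<integral>x. \<bar>f x - g x\<bar> \<partial>M) < e"
  using f \<open>0 < e\<close>
proof (induction arbitrary: e)
  interpret finite_measure M by fact
  case (base A c)
  define d where "d = e / (\<bar>c\<bar> + 1)"
  have d: "0 < d" "d * \<bar>c\<bar> < e" using \<open>0 < e\<close> by (auto simp: d_def field_simps)
  obtain i B where iB: "i \<in> I" "B \<in> sets (G i)" "measure M (sym_diff A B) < d"
    using approx_set_by_directed_subalgebras[OF \<open>finite_measure M\<close> G directed \<open>I \<noteq> {}\<close> gen base(1) d(1)] by blast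
  have BM[measurable]: "B \<in> sets M" using iB G by blast
  note [measurable] = \<open>A \<in> sets M\<close>
  have eq: "\<bar>indicator A x *\<^sub>R c - indicator B x * c\<bar> = indicator (sym_diff A B) x * \<bar>c\<bar>" for x
    by (auto simp: indicator_def)
  have "(\<integral>x. \<bar>indicator A x *\<^sub>R c - indicator B x * c\<bar> \<partial>M) = measure M (sym_diff A B) * \<bar>c\<bar>"
    unfolding eq by simp
  also have "\<dots> \<le> d * \<bar>c\<bar>" using iB by (intro mult_right_mono) auto
  finally have "(\<integral>x. \<bar>indicator A x *\<^sub>R c - indicator B x * c\<bar> \<partial>M) < e" using d by simp
  moreover have "integrable M (\<lambda>x. indicator B x * c)"
    by (intro integrable_mult_left integrable_real_indicator) (simp_all add: less_top[symmetric])
  ultimately show ?case using iB by (intro bexI[of _ i] bexI[of _ "\<lambda>x. indicator B x * c"]) auto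
next
  case (add f g)
  obtain i u where i: "i \<in> I" "u \<in> borel_measurable (G i)" "integrable M u" "(\<integral>x. \<bar>f x - u x\<bar> \<partial>M) < e/2"
    using add.IH(1)[of "e/2"] add.prems by auto
  obtain j v where j: "j \<in> I" "v \<in> borel_measurable (G j)" "integrable M v" "(\<integral>x. \<bar>g x - v x\<bar> \<partial>M) < e/2"
    using add.IH(2)[of "e/2"] add.prems by auto
  obtain k where k: "k \<in> I" "sets (G i) \<union> sets (G j) \<subseteq> sets (G k)"
    using directed i j by blast
  have "measurable (G i) borel \<subseteq> measurable (G k) (borel :: real measure)"
       "measurable (G j) borel \<subseteq> measurable (G k) (borel :: real measure)"
    by (intro measurable_mono; use i j k G in simp)+
  then have [measurable]: "u \<in> borel_measurable (G k)" "v \<in> borel_measurable (G k)"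
    using i j by auto
  have "(\<integral>x. \<bar>(f x + g x) - (u x + v x)\<bar> \<partial>M) \<le> (\<integral>x. \<bar>f x - u x\<bar> + \<bar>g x - v x\<bar> \<partial>M)"
    using add i j by (intro integral_mono) auto
  also have "\<dots> < e"
    using add i j by (subst Bochner_Integration.integral_add) auto
  finally show ?case
    using i j k by (intro bexI[of _ k] bexI[of _ "\<lambda>x. u x + v x"]) auto
next
  case (lim f s)
  have "(\<lambda>n. \<integral>x. \<bar>f x - s n x\<bar> \<partial>M) \<longlonglongrightarrow> (\<integral>x. 0 \<partial>M)"
  proof (rule integral_dominated_convergence[where w="\<lambda>x. 3 * \<bar>f x\<bar>"])
    show "AE x in M. (\<lambda>n. \<bar>f x - s n x\<bar>) \<longlonglongrightarrow> 0"
    proof (rule AE_I2)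
      fix x assume "x \<in> space M"
      then have "(\<lambda>n. \<bar>f x - s n x\<bar>) \<longlonglongrightarrow> \<bar>f x - f x\<bar>"
        using lim by (intro tendsto_intros) auto
      then show "(\<lambda>n. \<bar>f x - s n x\<bar>) \<longlonglongrightarrow> 0" by simp
    qed
    show "AE x in M. norm \<bar>f x - s n x\<bar> \<le> 3 * \<bar>f x\<bar>" for n
    proof (rule AE_I2)
      fix x assume "x \<in> space M"
      then show "norm \<bar>f x - s n x\<bar> \<le> 3 * \<bar>f x\<bar>" using lim.hyps(3)[of x n] by auto
    qed
  qed (use lim in auto)
  then have "\<forall>\<^sub>F n in sequentially. (\<integral>x. \<bar>f x - s n x\<bar> \<partial>M) < e/2"
    using lim.prems by (intro order_tendstoD) auto
  then obtain n where n: "(\<integral>x. \<bar>f x - s n x\<bar> \<partial>M) < e/2"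
    by (auto dest: eventually_happens)
  obtain i u where i: "i \<in> I" "u \<in> borel_measurable (G i)" "integrable M u" "(\<integral>x. \<bar>s n x - u x\<bar> \<partial>M) < e/2"
    using lim.IH half_gt_zero[OF lim.prems] by blast
  have "(\<integral>x. \<bar>f x - u x\<bar> \<partial>M) \<le> (\<integral>x. \<bar>f x - s n x\<bar> + \<bar>s n x - u x\<bar> \<partial>M)"
    using lim i by (intro integral_mono) auto
  also have "\<dots> < e"
    using lim i n by (subst Bochner_Integration.integral_add) auto
  finally show ?case using i by auto
qed

text \<open>
  An inequality between two probability measures that holds on every subalgebra survives in the
  limit: a bounded function is approximated in \<open>L\<^sup>1\<close> of a measure that dominates both, and truncating
  the approximant at the same bound makes its square converge too.  In this way the estimate for
  finitely many increments of the paths reaches all bounded statistics of the paths.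
\<close>

lemma expectation_diff_extends_from_directed_subalgebras:
  fixes G :: "'i \<Rightarrow> 'a measure" and f :: "'a \<Rightarrow> real"
  assumes P: "prob_space P" "sets P = sets M" and Q: "prob_space Q" "sets Q = sets M"
    and G: "\<And>i. i \<in> I \<Longrightarrow> space (G i) = space M" "\<And>i. i \<in> I \<Longrightarrow> sets (G i) \<subseteq> sets M"
    and directed: "\<And>i j. i \<in> I \<Longrightarrow> j \<in> I \<Longrightarrow> \<exists>k\<in>I. sets (G i) \<union> sets (G j) \<subseteq> sets (G k)"
    and "I \<noteq> {}"
    and gen: "sets M \<subseteq> sigma_sets (space M) (\<Union>i\<in>I. sets (G i))"
    and ineq: "\<And>i g B. i \<in> I \<Longrightarrow> g \<in> borel_measurable (G i) \<Longrightarrow> (\<And>x. \<bar>g x\<bar> \<le> B) \<Longrightarrow>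
        \<bar>(\<integral>x. g x \<partial>Q) - (\<integral>x. g x \<partial>P)\<bar> \<le> K * sqrt (\<integral>x. (g x)\<^sup>2 \<partial>P)"
    and "0 \<le> K"
    and f: "f \<in> borel_measurable M" and bnd: "\<And>x. \<bar>f x\<bar> \<le> B"
  shows "\<bar>(\<integral>x. f x \<partial>Q) - (\<integral>x. f x \<partial>P)\<bar> \<le> K * sqrt (\<integral>x. (f x)\<^sup>2 \<partial>P)"
proof -
  interpret P: prob_space P by (rule P)
  interpret Q: prob_space Q by (rule Q)
  have B0: "0 \<le> B" using bnd[of undefined] by linarith
  obtain \<mu> where \<mu>: "finite_measure \<mu>" and [measurable_cong]: "sets \<mu> = sets M" and
    \<mu>PQ: "P \<le> \<mu>" "Q \<le> \<mu>"
    using finite_measure_dominating_two[OF P.finite_measure_axioms P(2) Q.finite_measure_axioms Q(2)] by blast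
  interpret \<mu>: finite_measure \<mu> by (rule \<mu>)
  note [measurable_cong] = P(2) Q(2) and [measurable] = f
  have sp: "space \<mu> = space M" using sets_eq_imp_space_eq[of \<mu> M] by (simp add: \<open>sets \<mu> = sets M\<close>)
  have le_\<mu>: "(\<integral>x. \<bar>h x\<bar> \<partial>R) \<le> (\<integral>x. \<bar>h x\<bar> \<partial>\<mu>)"
    if "R = P \<or> R = Q" and h: "integrable \<mu> h" for h :: "'a \<Rightarrow> real" and R
  proof (rule integral_eq_nn_integral[THEN ord_eq_le_trans])
    have hM: "h \<in> borel_measurable M"
      using borel_measurable_integrable[OF h] by measurable
    show "(\<lambda>x. \<bar>h x\<bar>) \<in> borel_measurable R" using that hM by auto
    have "(\<integral>\<^sup>+x. ennreal \<bar>h x\<bar> \<partial>R) \<le> (\<integral>\<^sup>+x. ennreal \<bar>h x\<bar> \<partial>\<mu>)"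
      using that(1)
    proof (elim disjE)
      assume "R = P"
      then show ?thesis using \<mu>PQ(1) by (intro nn_integral_mono_measure) (simp_all add: P(2) \<open>sets \<mu> = sets M\<close>)
    next
      assume "R = Q"
      then show ?thesis using \<mu>PQ(2) by (intro nn_integral_mono_measure) (simp_all add: Q(2) \<open>sets \<mu> = sets M\<close>)
    qed
    also have "\<dots> = ennreal (\<integral>x. \<bar>h x\<bar> \<partial>\<mu>)"
      using h by (intro nn_integral_eq_integral) auto
    finally show "enn2real (\<integral>\<^sup>+x. ennreal \<bar>h x\<bar> \<partial>R) \<le> (\<integral>x. \<bar>h x\<bar> \<partial>\<mu>)"
      by (intro enn2real_leI) auto
  qed auto
  have bi: "integrable R h" if "R = P \<or> R = Q \<or> R = \<mu>" "h \<in> borel_measurable M" "\<And>x. \<bar>h x\<bar> \<le> C" for R h and C :: real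
  proof -
    have "finite_measure R" "sets R = sets M"
      using that(1) P.finite_measure_axioms Q.finite_measure_axioms \<mu> P(2) Q(2) \<open>sets \<mu> = sets M\<close>
      by fastforce+
    then show ?thesis
      using that(2,3) by (intro finite_measure.integrable_const_bound[of R _ C]) (simp_all cong: measurable_cong_sets)
  qed
  have fi: "integrable \<mu> f" using bnd by (intro bi) auto
  have approx: "\<bar>(\<integral>x. f x \<partial>Q) - (\<integral>x. f x \<partial>P)\<bar> \<le> 2 * e + K * sqrt ((\<integral>x. (f x)\<^sup>2 \<partial>P) + 2 * B * e)"
    if "0 < e" for e
  proof -
    obtain i g where i: "i \<in> I" "g \<in> borel_measurable (G i)" "integrable \<mu> g" "(\<integral>x. \<bar>f x - g x\<bar> \<partial>\<mu>) < e"
      using approx_integrable_by_directed_subalgebras[OF \<mu>, unfolded sp \<open>sets \<mu> = sets M\<close>,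
          OF G directed \<open>I \<noteq> {}\<close> gen fi \<open>0 < e\<close>] by metis
    define h where "h x = max (- B) (min B (g x))" for x
    have h[measurable]: "h \<in> borel_measurable (G i)" unfolding h_def using i(2) by measurable
    have hb: "\<bar>h x\<bar> \<le> B" for x using B0 by (auto simp: h_def)
    have "borel_measurable (G i) \<subseteq> (borel_measurable M :: ('a \<Rightarrow> real) set)"
      using i G by (intro measurable_mono) auto
    with h have hM[measurable]: "h \<in> borel_measurable M" by blast
    have hi: "integrable \<mu> h" by (intro bi[of _ _ B]) (auto simp: hb)
    have "(\<integral>x. \<bar>f x - h x\<bar> \<partial>\<mu>) \<le> (\<integral>x. \<bar>f x - g x\<bar> \<partial>\<mu>)"
    proof (rule integral_mono)
      show "\<bar>f x - h x\<bar> \<le> \<bar>f x - g x\<bar>" for x using bnd[of x] by (auto simp: h_def)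
    qed (use fi hi i in auto)
    with i have "(\<integral>x. \<bar>f x - h x\<bar> \<partial>\<mu>) < e" by simp
    then have close: "(\<integral>x. \<bar>f x - h x\<bar> \<partial>R) < e" if "R = P \<or> R = Q" for R
      using le_\<mu>[OF that, of "\<lambda>x. f x - h x"] fi hi by auto
    have ints: "integrable R f" "integrable R h" "integrable R (\<lambda>x. (f x)\<^sup>2)" "integrable R (\<lambda>x. (h x)\<^sup>2)" if "R = P \<or> R = Q" for R
    proof -
      have R: "R = P \<or> R = Q \<or> R = \<mu>" using that by blast
      have sq: "\<bar>(f x)\<^sup>2\<bar> \<le> B\<^sup>2" "\<bar>(h x)\<^sup>2\<bar> \<le> B\<^sup>2" for x
        using power_mono[OF bnd abs_ge_zero, where n = 2] power_mono[OF hb abs_ge_zero, where n = 2] by auto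
      show "integrable R f" "integrable R h" "integrable R (\<lambda>x. (f x)\<^sup>2)" "integrable R (\<lambda>x. (h x)\<^sup>2)"
        by (rule bi[OF R _ bnd] bi[OF R _ hb] bi[OF R _ sq(1)] bi[OF R _ sq(2)]; measurable)+
    qed
    have diff: "\<bar>(\<integral>x. f x \<partial>R) - (\<integral>x. h x \<partial>R)\<bar> < e" if "R = P \<or> R = Q" for R
      using integral_abs_bound[of R "\<lambda>x. f x - h x"] close[OF that] ints[OF that] by simp
    have "(\<integral>x. (h x)\<^sup>2 \<partial>P) \<le> (\<integral>x. (f x)\<^sup>2 + 2 * B * \<bar>f x - h x\<bar> \<partial>P)"
    proof (rule integral_mono)
      fix x
      have "(h x)\<^sup>2 - (f x)\<^sup>2 = (h x + f x) * (h x - f x)" by (simp add: power2_eq_square algebra_simps)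
      also have "\<dots> \<le> \<bar>h x + f x\<bar> * \<bar>f x - h x\<bar>" by (metis abs_ge_self abs_minus_commute abs_mult)
      also have "\<dots> \<le> 2 * B * \<bar>f x - h x\<bar>"
        using hb[of x] bnd[of x] by (intro mult_right_mono) auto
      finally show "(h x)\<^sup>2 \<le> (f x)\<^sup>2 + 2 * B * \<bar>f x - h x\<bar>" by simp
    qed (use ints in auto)
    also have "\<dots> = (\<integral>x. (f x)\<^sup>2 \<partial>P) + 2 * B * (\<integral>x. \<bar>f x - h x\<bar> \<partial>P)"
      using ints by (subst Bochner_Integration.integral_add) auto
    also have "\<dots> \<le> (\<integral>x. (f x)\<^sup>2 \<partial>P) + 2 * B * e"
      using close[OF disjI1[OF refl]] B0 by (intro add_left_mono mult_left_mono) auto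
    finally have "K * sqrt (\<integral>x. (h x)\<^sup>2 \<partial>P) \<le> K * sqrt ((\<integral>x. (f x)\<^sup>2 \<partial>P) + 2 * B * e)"
      using \<open>0 \<le> K\<close> by (intro mult_left_mono) auto
    with ineq[OF i(1) h hb] diff[OF disjI1[OF refl]] diff[OF disjI2[OF refl]] show ?thesis by linarith
  qed
  have "((\<lambda>e. 2 * e + K * sqrt ((\<integral>x. (f x)\<^sup>2 \<partial>P) + 2 * B * e)) \<longlongrightarrow>
      2 * 0 + K * sqrt ((\<integral>x. (f x)\<^sup>2 \<partial>P) + 2 * B * 0)) (at_right 0)"
    by (intro tendsto_intros)
  then have "\<bar>(\<integral>x. f x \<partial>Q) - (\<integral>x. f x \<partial>P)\<bar> \<le> 2 * 0 + K * sqrt ((\<integral>x. (f x)\<^sup>2 \<partial>P) + 2 * B * 0)"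
    by (rule tendsto_lowerbound) (use approx in \<open>auto intro!: eventually_at_rightI[of 0 1]\<close>)
  then show ?thesis by simp
qed

section \<open>Increments of Poisson samples over a finite grid\<close>

lemma second_moment_le_mono:
  "second_moment_le c P Q \<Longrightarrow> c \<le> c' \<Longrightarrow> second_moment_le c' P Q"
  unfolding second_moment_le_def by (meson ennreal_leI order_trans)

text \<open>
  The sum behind the second moment is \<open>\<Sum>k. (b\<^sup>2 / a) ^ k / k! * exp (a - 2 * b)\<close>, an exponential series
  with value \<open>exp (b\<^sup>2 / a + a - 2 * b)\<close>.
\<close>

lemma second_moment_le_poisson:
  assumes a: "0 < a" and b: "0 < b"
  shows "second_moment_le (exp ((b - a)\<^sup>2 / a)) (measure_pmf (poisson_pmf a)) (measure_pmf (poisson_pmf b))"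
proof -
  let ?p = "pmf (poisson_pmf a)" and ?q = "pmf (poisson_pmf b)"
  let ?\<rho> = "\<lambda>k. ?q k / ?p k"
  have p0: "?p k > 0" for k using a by simp
  have "measure_pmf (poisson_pmf b) = density (measure_pmf (poisson_pmf a)) (\<lambda>k. ennreal (?\<rho> k))"
  proof (rule measure_eqI_countable[of _ UNIV])
    fix k :: nat
    have "emeasure (density (measure_pmf (poisson_pmf a)) (\<lambda>k. ennreal (?\<rho> k))) {k} =
        ennreal (?\<rho> k) * emeasure (measure_pmf (poisson_pmf a)) {k}"
      by (subst emeasure_density) simp_all
    also have "\<dots> = ennreal (?q k)"
      using p0[of k] by (simp add: emeasure_pmf_single flip: ennreal_mult)
    finally show "emeasure (measure_pmf (poisson_pmf b)) {k} =
      emeasure (density (measure_pmf (poisson_pmf a)) (\<lambda>k. ennreal (?\<rho> k))) {k}"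
      by (simp add: emeasure_pmf_single)
  qed auto
  moreover have "(\<integral>\<^sup>+k. ennreal ((?\<rho> k)\<^sup>2) \<partial>measure_pmf (poisson_pmf a)) = ennreal (exp ((b - a)\<^sup>2 / a))"
  proof -
    have "(\<integral>\<^sup>+k. ennreal ((?\<rho> k)\<^sup>2) \<partial>measure_pmf (poisson_pmf a)) = (\<Sum>k. ennreal (?p k * (?\<rho> k)\<^sup>2))"
      by (simp add: nn_integral_measure_pmf nn_integral_count_space_nat ennreal_mult)
    also have "\<dots> = ennreal (exp (b\<^sup>2 / a) * exp (a - 2 * b))"
    proof (rule suminf_ennreal_eq)
      have "?p k * (?\<rho> k)\<^sup>2 = (b\<^sup>2 / a) ^ k /\<^sub>R fact k * exp (a - 2 * b)" for k
      proof -
        have "?p k * (?\<rho> k)\<^sup>2 = (?q k)\<^sup>2 / ?p k"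
          using p0[of k] by (simp add: power2_eq_square)
        also have "\<dots> = (b ^ k)\<^sup>2 / a ^ k / fact k * ((exp (- b))\<^sup>2 / exp (- a))"
          using a b by (simp add: power2_eq_square field_simps)
        also have "(exp (- b))\<^sup>2 / exp (- a) = exp (a - 2 * b)"
          by (simp add: exp_diff exp_minus field_simps power2_eq_square exp_add[symmetric])
        finally show ?thesis
          by (simp add: power_inverse power_mult_distrib power_mult[symmetric] mult.commute divide_inverse)
      qed
      then show "(\<lambda>k. ?p k * (?\<rho> k)\<^sup>2) sums (exp (b\<^sup>2 / a) * exp (a - 2 * b))"
        using sums_mult2[OF exp_converges[of "b\<^sup>2 / a"], of "exp (a - 2 * b)"] by simp
    qed auto
    also have "exp (b\<^sup>2 / a) * exp (a - 2 * b) = exp ((b - a)\<^sup>2 / a)"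
      using a by (simp add: exp_add[symmetric] power2_eq_square field_simps)
    finally show ?thesis .
  qed
  ultimately show ?thesis
    unfolding second_moment_le_def by (intro bexI[of _ ?\<rho>]) auto
qed

definition grid_point :: "real set \<Rightarrow> nat \<Rightarrow> real" where
  "grid_point J i = sorted_list_of_set J ! i"

text \<open>
  Both end points belong to every grid, so that the grid intervals cover the whole observation
  period and there is at least one of them.
\<close>

definition grids :: "real \<Rightarrow> real set set" where
  "grids \<tau> = {J. finite J \<and> {0, \<tau>} \<subseteq> J \<and> J \<subseteq> {0..\<tau>}}"

lemma grid_point_props:
  assumes J: "J \<in> grids \<tau>" and "0 < \<tau>"
  shows "strict_mono_on {..card J - 1} (grid_point J)" "grid_point J 0 = 0" "grid_point J (card J - 1) = \<tau>"
    "bij_betw (grid_point J) {..card J - 1} J" "0 < card J - 1"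
proof -
  from J have fin: "finite J" "0 \<in> J" "\<tau> \<in> J" "J \<subseteq> {0..\<tau>}" by (auto simp: grids_def)
  have "card {0, \<tau>} \<le> card J" using fin by (intro card_mono) auto
  then have c: "2 \<le> card J" using \<open>0 < \<tau>\<close> by simp
  then show "0 < card J - 1" by simp
  have less: "grid_point J i < grid_point J j" if "i < j" "j < card J" for i j
    using that sorted_wrt_nth_less[OF strict_sorted_list_of_set[of J]] by (simp add: grid_point_def)
  show sm: "strict_mono_on {..card J - 1} (grid_point J)"
    using c by (intro strict_mono_onI less) auto
  have eq: "{..card J - 1} = {..<card J}" using c by auto
  have "bij_betw (grid_point J) {..<length (sorted_list_of_set J)} (set (sorted_list_of_set J))"
    unfolding grid_point_def by (rule bij_betw_nth) auto
  then show bij: "bij_betw (grid_point J) {..card J - 1} J"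
    unfolding eq using fin by simp
  have mem: "grid_point J i \<in> {0..\<tau>}" if "i < card J" for i
    using bij_betwE[OF bij] that eq fin by blast
  obtain m where m: "m < card J" "grid_point J m = 0"
    using bij fin unfolding eq bij_betw_def by (metis imageE lessThan_iff)
  have "m = 0" using less[of 0 m] m mem[of 0] by fastforce
  then show "grid_point J 0 = 0" using m by simp
  obtain m where m: "m < card J" "grid_point J m = \<tau>"
    using bij fin unfolding eq bij_betw_def by (metis imageE lessThan_iff)
  have "m = card J - 1" using less[of m "card J - 1"] m mem[of "card J - 1"] c by fastforce
  then show "grid_point J (card J - 1) = \<tau>" using m by simp
qed

lemma grid_point_in_range:
  assumes "J \<in> grids \<tau>" "0 < \<tau>" "i \<le> card J - 1"
  shows "grid_point J i \<in> {0..\<tau>}"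
  using bij_betwE[OF grid_point_props(4)[OF assms(1,2)]] assms(1,3) unfolding grids_def by blast

definition increments :: "nat \<Rightarrow> real set \<Rightarrow> (nat \<Rightarrow> real \<Rightarrow> nat) \<Rightarrow> nat \<Rightarrow> nat \<Rightarrow> nat" where
  "increments n J x =
     (\<lambda>j\<in>{1..n}. \<lambda>i\<in>{..<card J - 1}. x j (grid_point J (Suc i)) - x j (grid_point J i))"

definition increment_space :: "nat \<Rightarrow> real set \<Rightarrow> (nat \<Rightarrow> nat \<Rightarrow> nat) measure" where
  "increment_space n J = PiM {1..n} (\<lambda>_. PiM {..<card J - 1} (\<lambda>_. count_space UNIV))"

definition increment_algebra :: "real \<Rightarrow> nat \<Rightarrow> real set \<Rightarrow> (nat \<Rightarrow> real \<Rightarrow> nat) measure" where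
  "increment_algebra \<tau> n J =
     vimage_algebra (space (sample_space \<tau> n)) (increments n J) (increment_space n J)"

lemma measurable_path_space_component:
  assumes "t \<in> {0..\<tau>}"
  shows "(\<lambda>x. x t) \<in> path_space \<tau> \<rightarrow>\<^sub>M count_space UNIV"
  unfolding path_space_def by (intro measurable_restrict_space1 measurable_component_singleton assms)

lemma space_sample_spaceD:
  assumes "x \<in> space (sample_space \<tau> n)" "j \<in> {1..n}"
  shows "x j 0 = 0" "mono_on {0..\<tau>} (x j)"
  using assms by (auto simp: sample_space_def path_space_def space_PiM space_restrict_space counting_paths_def PiE_iff)

lemma measurable_diff_nat:
  fixes f g :: "'a \<Rightarrow> nat"
  assumes "f \<in> M \<rightarrow>\<^sub>M count_space UNIV" "g \<in> M \<rightarrow>\<^sub>M count_space UNIV"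
  shows "(\<lambda>x. f x - g x) \<in> M \<rightarrow>\<^sub>M count_space UNIV"
  using assms by measurable

lemma measurable_increments:
  assumes J: "J \<in> grids \<tau>" and "0 < \<tau>"
    and coord: "\<And>j t. j \<in> {1..n} \<Longrightarrow> t \<in> J \<Longrightarrow> (\<lambda>x. x j t) \<in> H \<rightarrow>\<^sub>M count_space UNIV"
  shows "increments n J \<in> H \<rightarrow>\<^sub>M increment_space n J"
  unfolding increments_def[abs_def] increment_space_def
proof (intro measurable_restrict)
  fix j i assume "j \<in> {1..n}" "i \<in> {..<card J - 1}"
  then have "grid_point J i \<in> J" "grid_point J (Suc i) \<in> J"
    using grid_point_props(4)[OF J \<open>0 < \<tau>\<close>] by (auto simp: bij_betw_def)
  with coord[OF \<open>j \<in> {1..n}\<close>]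
  show "(\<lambda>x. x j (grid_point J (Suc i)) - x j (grid_point J i)) \<in> H \<rightarrow>\<^sub>M count_space UNIV"
    by (intro measurable_diff_nat) auto
qed

lemma measurable_increments_sample_space:
  assumes J: "J \<in> grids \<tau>" and "0 < \<tau>"
  shows "increments n J \<in> sample_space \<tau> n \<rightarrow>\<^sub>M increment_space n J"
proof (rule measurable_increments[OF assms])
  fix j t assume j: "j \<in> {1..n}" "t \<in> J"
  then have "t \<in> {0..\<tau>}" using J by (auto simp: grids_def)
  from measurable_compose[OF measurable_component_singleton[OF j(1)] measurable_path_space_component[OF this]]
  show "(\<lambda>x. x j t) \<in> sample_space \<tau> n \<rightarrow>\<^sub>M count_space UNIV"
    unfolding sample_space_def .
qed

text \<open>
  Paths start in \<open>0\<close> and are nondecreasing, so the value at a grid point is recovered as the sum of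
  the increments before it.  Hence the increments carry the same information as the values on the
  grid, which makes their \<open>\<sigma>\<close>-algebras monotone in the grid.
\<close>

lemma measurable_coordinate_increment_algebra:
  assumes J: "J \<in> grids \<tau>" and \<tau>: "0 < \<tau>" and j: "j \<in> {1..n}" and t: "t \<in> J"
  shows "(\<lambda>x. x j t) \<in> increment_algebra \<tau> n J \<rightarrow>\<^sub>M count_space UNIV"
proof -
  note gp = grid_point_props[OF J \<open>0 < \<tau>\<close>]
  obtain m where m: "m \<le> card J - 1" "t = grid_point J m"
    using gp(4) t by (auto simp: bij_betw_def)
  have "increments n J \<in> increment_algebra \<tau> n J \<rightarrow>\<^sub>M increment_space n J"
    unfolding increment_algebra_def
    by (intro measurable_vimage_algebra1)
      (auto intro: measurable_space[OF measurable_increments_sample_space[OF J \<open>0 < \<tau>\<close>]])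
  then have "(\<lambda>x. increments n J x j i) \<in> increment_algebra \<tau> n J \<rightarrow>\<^sub>M count_space UNIV" if "i < m" for i
    using that m j unfolding increment_space_def
    by (intro measurable_compose[OF measurable_compose[OF _ measurable_component_singleton[of j]] measurable_component_singleton[of i]]) auto
  then have "(\<lambda>x. \<Sum>i<m. increments n J x j i) \<in> increment_algebra \<tau> n J \<rightarrow>\<^sub>M count_space UNIV"
  proof (induction m)
    case (Suc m)
    then have [measurable]: "(\<lambda>x. \<Sum>i<m. increments n J x j i) \<in> increment_algebra \<tau> n J \<rightarrow>\<^sub>M count_space UNIV"
      "(\<lambda>x. increments n J x j m) \<in> increment_algebra \<tau> n J \<rightarrow>\<^sub>M count_space UNIV" by auto
    show ?case unfolding sum.lessThan_Suc by measurable
  qed simp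
  also have "?this \<longleftrightarrow> ?thesis"
  proof (rule measurable_cong)
    fix x assume "x \<in> space (increment_algebra \<tau> n J)"
    then have x: "x \<in> space (sample_space \<tau> n)" by (simp add: increment_algebra_def)
    have "l \<le> card J - 1 \<Longrightarrow> (\<Sum>i<l. increments n J x j i) = x j (grid_point J l)" for l
    proof (induction l)
      case 0
      then show ?case using space_sample_spaceD(1)[OF x j] gp by simp
    next
      case (Suc l)
      have mem: "grid_point J l \<in> {0..\<tau>}" "grid_point J (Suc l) \<in> {0..\<tau>}"
        using grid_point_in_range[OF J \<tau>] Suc.prems by auto
      have "grid_point J l < grid_point J (Suc l)"
        using Suc.prems by (intro strict_mono_onD[OF gp(1)]) auto
      then have "x j (grid_point J l) \<le> x j (grid_point J (Suc l))"
        using mem by (intro mono_onD[OF space_sample_spaceD(2)[OF x j]]) auto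
      then show ?case using Suc j by (simp add: increments_def)
    qed
    with m show "(\<Sum>i<m. increments n J x j i) = x j t" by simp
  qed
  finally show ?thesis .
qed

lemma increment_algebra_mono:
  assumes "J \<in> grids \<tau>" "K \<in> grids \<tau>" "J \<subseteq> K" "0 < \<tau>"
  shows "sets (increment_algebra \<tau> n J) \<subseteq> sets (increment_algebra \<tau> n K)"
proof -
  have "increments n J \<in> increment_algebra \<tau> n K \<rightarrow>\<^sub>M increment_space n J"
    using assms by (intro measurable_increments[of J \<tau>] measurable_coordinate_increment_algebra) auto
  then show ?thesis
    unfolding increment_algebra_def[of \<tau> n J] by (intro sets_image_in_sets) (simp_all add: increment_algebra_def)
qed

lemma sets_increment_algebra_subset:
  assumes "J \<in> grids \<tau>" "0 < \<tau>"
  shows "sets (increment_algebra \<tau> n J) \<subseteq> sets (sample_space \<tau> n)"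
  unfolding increment_algebra_def
  by (intro sets_image_in_sets measurable_increments_sample_space assms) simp

text \<open>
  Each single coordinate \<open>x j t\<close> is measurable for the grid \<open>{0, t, \<tau>}\<close>, and the coordinates generate
  the \<open>\<sigma>\<close>-algebra of the sample space.
\<close>

lemma sets_sample_space_generated:
  assumes "0 < \<tau>"
  shows "sets (sample_space \<tau> n) \<subseteq>
    sigma_sets (space (sample_space \<tau> n)) (\<Union>J\<in>grids \<tau>. sets (increment_algebra \<tau> n J))"
proof -
  let ?\<Omega> = "space (sample_space \<tau> n)" and ?E = "\<Union>J\<in>grids \<tau>. sets (increment_algebra \<tau> n J)"
  let ?S = "sigma ?\<Omega> ?E"
  have E: "?E \<subseteq> Pow ?\<Omega>"
    using sets_increment_algebra_subset[OF _ assms] sets.space_closed[of "sample_space \<tau> n"] by blast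
  have sp: "space ?S = ?\<Omega>" using E by (simp add: space_measure_of)
  have coord: "(\<lambda>x. x j t) \<in> ?S \<rightarrow>\<^sub>M count_space UNIV" if j: "j \<in> {1..n}" and t: "t \<in> {0..\<tau>}" for j t
  proof -
    have J: "{0, t, \<tau>} \<in> grids \<tau>" using t by (auto simp: grids_def)
    have "(\<lambda>x. x j t) \<in> increment_algebra \<tau> n {0, t, \<tau>} \<rightarrow>\<^sub>M count_space UNIV"
      using measurable_coordinate_increment_algebra[OF J assms j] by simp
    moreover have "sets (increment_algebra \<tau> n {0, t, \<tau>}) \<subseteq> sets ?S"
      unfolding sets_measure_of[OF E] using J by (blast intro: sigma_sets.Basic)
    moreover have "space (increment_algebra \<tau> n {0, t, \<tau>}) = space ?S"
      by (simp only: sp increment_algebra_def[of \<tau> n "{0, t, \<tau>}"] space_vimage_algebra)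
    ultimately show ?thesis
      using measurable_mono[OF order_refl refl] by blast
  qed
  have "(\<lambda>x j. x j) \<in> ?S \<rightarrow>\<^sub>M PiM {1..n} (\<lambda>_. path_space \<tau>)"
  proof (rule measurable_PiM_single')
    show "(\<lambda>\<omega> i. \<omega> i) \<in> space ?S \<rightarrow> (\<Pi>\<^sub>E i\<in>{1..n}. space (path_space \<tau>))"
      unfolding sp by (simp add: sample_space_def space_PiM)
    fix j assume j: "j \<in> {1..n}"
    have range: "\<omega> j \<in> space (path_space \<tau>)" if "\<omega> \<in> space ?S" for \<omega>
      using that j unfolding sp by (auto simp: sample_space_def space_PiM)
    show "(\<lambda>\<omega>. \<omega> j) \<in> ?S \<rightarrow>\<^sub>M path_space \<tau>"
      unfolding path_space_def
    proof (rule measurable_restrict_space2)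
      show "(\<lambda>\<omega>. \<omega> j) \<in> space ?S \<rightarrow> counting_paths \<tau>"
        using range by (auto simp: path_space_def space_restrict_space)
      have "(\<lambda>\<omega> t. \<omega> j t) \<in> ?S \<rightarrow>\<^sub>M PiM {0..\<tau>} (\<lambda>_. count_space UNIV)"
      proof (rule measurable_PiM_single')
        show "(\<lambda>\<omega>. \<omega> j t) \<in> ?S \<rightarrow>\<^sub>M count_space UNIV" if "t \<in> {0..\<tau>}" for t
          by (rule coord[OF j that])
        show "(\<lambda>\<omega> t. \<omega> j t) \<in> space ?S \<rightarrow> (\<Pi>\<^sub>E t\<in>{0..\<tau>}. space (count_space UNIV))"
          using range by (auto simp: path_space_def space_restrict_space space_PiM)
      qed
      then show "(\<lambda>\<omega>. \<omega> j) \<in> ?S \<rightarrow>\<^sub>M PiM {0..\<tau>} (\<lambda>_. count_space UNIV)" by simp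
    qed
  qed
  then have id: "(\<lambda>x. x) \<in> ?S \<rightarrow>\<^sub>M sample_space \<tau> n"
    by (simp only: sample_space_def[of \<tau> n, symmetric])
  show ?thesis
  proof
    fix A assume A: "A \<in> sets (sample_space \<tau> n)"
    have "(\<lambda>x. x) -` A \<inter> space ?S \<in> sets ?S" by (rule measurable_sets[OF id A])
    moreover have "(\<lambda>x. x) -` A \<inter> space ?S = A" using sets.sets_into_space[OF A] sp by auto
    ultimately show "A \<in> sigma_sets ?\<Omega> ?E" using E by (simp add: sets_measure_of)
  qed
qed

text \<open>
  Two layers of independence enter: between the \<open>n\<close> processes, and between the increments of one
  process.  The law is therefore a product of products of Poisson distributions.
\<close>

lemma distr_increments_sample_law:
  assumes S: "poisson_sample M \<tau> lam n X" and "1 \<le> n" and J: "J \<in> grids \<tau>" and \<tau>: "0 < \<tau>"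
  defines "\<Lambda> \<equiv> \<lambda>i. LBINT u:{grid_point J i..grid_point J (Suc i)}. lam u"
  assumes pos: "\<And>i. i < card J - 1 \<Longrightarrow> 0 < \<Lambda> i"
  shows "distr (sample_law M \<tau> n X) (increment_space n J) (increments n J) =
    PiM {1..n} (\<lambda>_. PiM {..<card J - 1} (\<lambda>i. measure_pmf (poisson_pmf (\<Lambda> i))))"
proof -
  have pp: "poisson_process M \<tau> lam (X j)" if "j \<in> {1..n}" for j
    using S that by (simp add: poisson_sample_def)
  have indep: "prob_space.indep_vars M (\<lambda>_. path_space \<tau>) X {1..n}"
    using S by (simp add: poisson_sample_def)
  interpret prob_space M
    using pp[of 1] \<open>1 \<le> n\<close> by (auto simp: poisson_process_def)
  note gp = grid_point_props[OF J \<tau>]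
  let ?k = "card J - 1" and ?t = "grid_point J"
  let ?I = "PiM {..<?k} (\<lambda>_. count_space UNIV) :: (nat \<Rightarrow> nat) measure"
  define inc :: "(real \<Rightarrow> nat) \<Rightarrow> nat \<Rightarrow> nat" where "inc x = (\<lambda>i\<in>{..<?k}. x (?t (Suc i)) - x (?t i))" for x
  have tJ: "?t i \<in> {0..\<tau>}" if "i \<le> ?k" for i
    using grid_point_in_range[OF J \<tau>] that by simp
  have Xm: "X j \<in> M \<rightarrow>\<^sub>M path_space \<tau>" if "j \<in> {1..n}" for j
    using pp[OF that] by (simp add: poisson_process.measurable_path)
  have inc_m: "inc \<in> path_space \<tau> \<rightarrow>\<^sub>M ?I"
    unfolding inc_def[abs_def]
  proof (intro measurable_restrict)
    fix i assume "i \<in> {..<?k}"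
    then show "(\<lambda>x. x (?t (Suc i)) - x (?t i)) \<in> path_space \<tau> \<rightarrow>\<^sub>M count_space UNIV"
      by (intro measurable_diff_nat measurable_path_space_component tJ) auto
  qed
  have one: "distr M ?I (\<lambda>\<omega>. inc (X j \<omega>)) = PiM {..<?k} (\<lambda>i. measure_pmf (poisson_pmf (\<Lambda> i)))"
    if j: "j \<in> {1..n}" for j
  proof -
    interpret poisson_process M \<tau> lam "X j" by (rule pp[OF j])
    have mo: "mono_on {..?k} ?t" using gp(1) by (rule strict_mono_on_imp_mono_on)
    have ind: "indep_vars (\<lambda>_. count_space UNIV) (\<lambda>i \<omega>. X j \<omega> (?t (Suc i)) - X j \<omega> (?t i)) {..<?k}"
      using independent_increments[OF mo] gp by simp
    then have rv: "random_variable (count_space UNIV) (\<lambda>\<omega>. X j \<omega> (?t (Suc i)) - X j \<omega> (?t i))" if "i \<in> {..<?k}" for i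
      using that by (auto simp: indep_vars_def)
    have ne: "{..<?k} \<noteq> {}" using gp(5) by (metis lessThan_iff empty_iff)
    have "distr M ?I (\<lambda>\<omega>. inc (X j \<omega>)) =
        PiM {..<?k} (\<lambda>i. distr M (count_space UNIV) (\<lambda>\<omega>. X j \<omega> (?t (Suc i)) - X j \<omega> (?t i)))"
      unfolding inc_def using iffD1[OF indep_vars_iff_distr_eq_PiM'[OF ne rv] ind] by simp
    also have "\<dots> = PiM {..<?k} (\<lambda>i. measure_pmf (poisson_pmf (\<Lambda> i)))"
    proof (intro PiM_cong refl)
      fix i assume i: "i \<in> {..<?k}"
      show "distr M (count_space UNIV) (\<lambda>\<omega>. X j \<omega> (?t (Suc i)) - X j \<omega> (?t i)) = measure_pmf (poisson_pmf (\<Lambda> i))"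
      proof (rule measure_eqI_countable[of _ UNIV])
        fix k :: nat
        have "?t i < ?t (Suc i)" using i by (intro strict_mono_onD[OF gp(1)]) auto
        then have "prob {\<omega> \<in> space M. X j \<omega> (?t (Suc i)) - X j \<omega> (?t i) = k} = pmf (poisson_pmf (\<Lambda> i)) k"
          using i tJ[of i] tJ[of "Suc i"] pos[of i] by (subst poisson_increments) (auto simp: \<Lambda>_def)
        then show "emeasure (distr M (count_space UNIV) (\<lambda>\<omega>. X j \<omega> (?t (Suc i)) - X j \<omega> (?t i))) {k} =
            emeasure (measure_pmf (poisson_pmf (\<Lambda> i))) {k}"
          using rv[OF i]
          by (subst emeasure_distr) (auto simp: emeasure_pmf_single emeasure_eq_measure vimage_def Int_def conj_commute)
      qed auto
    qed
    finally show ?thesis .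
  qed
  have "distr (sample_law M \<tau> n X) (increment_space n J) (increments n J) =
      distr M (increment_space n J) (increments n J \<circ> (\<lambda>\<omega>. \<lambda>j\<in>{1..n}. X j \<omega>))"
    unfolding sample_law_def
    using Xm by (intro distr_distr measurable_increments_sample_space[OF J \<tau>]) (auto simp: sample_space_def intro!: measurable_restrict)
  also have "increments n J \<circ> (\<lambda>\<omega>. \<lambda>j\<in>{1..n}. X j \<omega>) = (\<lambda>\<omega>. \<lambda>j\<in>{1..n}. inc (X j \<omega>))"
    by (auto simp: increments_def inc_def fun_eq_iff restrict_def)
  also have "distr M (increment_space n J) (\<lambda>\<omega>. \<lambda>j\<in>{1..n}. inc (X j \<omega>)) =
      PiM {1..n} (\<lambda>j. distr M ?I (\<lambda>\<omega>. inc (X j \<omega>)))"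
    unfolding increment_space_def
    using \<open>1 \<le> n\<close> indep_vars_compose2[OF indep inc_m] Xm inc_m
    by (subst indep_vars_iff_distr_eq_PiM'[symmetric]) (auto intro: measurable_compose)
  also have "\<dots> = PiM {1..n} (\<lambda>_. PiM {..<?k} (\<lambda>i. measure_pmf (poisson_pmf (\<Lambda> i))))"
    by (intro PiM_cong refl one)
  finally show ?thesis .
qed

section \<open>Comparison of the laws of two Poisson samples\<close>

lemma set_integral_grid_sum:
  fixes g :: "real \<Rightarrow> real"
  assumes J: "J \<in> grids \<tau>" and \<tau>: "0 < \<tau>" and g: "set_integrable lborel {0..\<tau>} g"
  shows "(\<Sum>i<card J - 1. LBINT u:{grid_point J i..grid_point J (Suc i)}. g u) = (LBINT u:{0..\<tau>}. g u)"
proof -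
  note gp = grid_point_props[OF J \<tau>]
  have mono: "grid_point J i \<le> grid_point J j" if "i \<le> j" "j \<le> card J - 1" for i j
    using mono_onD[OF strict_mono_on_imp_mono_on[OF gp(1)], of i j] that by simp
  have int: "interval_lebesgue_integrable lborel (ereal a) (ereal b) g" if "a \<le> b" "0 \<le> a" "b \<le> \<tau>" for a b
  proof -
    have "set_integrable lborel {a<..<b} g"
      by (rule set_integrable_subset[OF g]) (use that in auto)
    then show ?thesis using that by (simp add: interval_lebesgue_integrable_def einterval_eq)
  qed
  have "m \<le> card J - 1 \<Longrightarrow> (\<Sum>i<m. LBINT u:{grid_point J i..grid_point J (Suc i)}. g u) =
      (LBINT u=0..grid_point J m. g u)" for m
  proof (induction m)
    case 0
    then show ?case by (simp add: gp zero_ereal_def)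
  next
    case (Suc m)
    have r: "0 \<le> grid_point J m" "grid_point J m \<le> grid_point J (Suc m)" "grid_point J (Suc m) \<le> \<tau>"
      using mono[of 0 m] mono[of m "Suc m"] mono[of "Suc m" "card J - 1"] Suc.prems gp by auto
    have "(LBINT u=ereal 0..grid_point J m. g u) + (LBINT u=grid_point J m..grid_point J (Suc m). g u) =
        (LBINT u=ereal 0..grid_point J (Suc m). g u)"
      using r by (intro interval_integral_sum) (auto intro!: int simp: min_def max_def)
    with Suc r show ?case by (simp add: interval_integral_Icc zero_ereal_def)
  qed
  from this[of "card J - 1"] gp \<tau> show ?thesis
    by (simp add: interval_integral_Icc zero_ereal_def)
qed

lemma set_integral_lower_bound:
  fixes f :: "real \<Rightarrow> real"
  assumes f: "set_integrable lborel {s..t} f" and m: "\<And>u. u \<in> {s..t} \<Longrightarrow> m \<le> f u" and "s \<le> t"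
  shows "m * (t - s) \<le> (LBINT u:{s..t}. f u)"
proof -
  have "(LBINT u:{s..t}. m) \<le> (LBINT u:{s..t}. f u)"
  proof (rule set_integral_mono)
    show "set_integrable lborel {s..t} (\<lambda>u. m)"
      by (intro borel_integrable_atLeastAtMost' continuous_intros)
  qed (use f m in auto)
  then show ?thesis
    using \<open>s \<le> t\<close> by (simp add: set_lebesgue_integral_def mult.commute)
qed

text \<open>
  This is Cauchy-Schwarz.  It is obtained by integrating \<open>(g - f)\<^sup>2 / f \<ge> 2 * c * (g - f) - c\<^sup>2 * f\<close>, which
  is \<open>(g - f - c * f)\<^sup>2 \<ge> 0\<close> divided by \<open>f\<close>, for the optimal constant \<open>c\<close>.
\<close>

lemma squared_increment_le_integral:
  fixes f g :: "real \<Rightarrow> real"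
  assumes f: "set_integrable lborel A f" and g: "set_integrable lborel A g"
    and h: "set_integrable lborel A (\<lambda>u. (g u - f u)\<^sup>2 / f u)"
    and pos: "\<And>u. u \<in> A \<Longrightarrow> 0 < f u" and a: "0 < (LBINT u:A. f u)"
  shows "((LBINT u:A. g u) - (LBINT u:A. f u))\<^sup>2 / (LBINT u:A. f u) \<le> (LBINT u:A. (g u - f u)\<^sup>2 / f u)"
proof -
  let ?a = "LBINT u:A. f u" and ?b = "LBINT u:A. g u"
  define c where "c = (?b - ?a) / ?a"
  have "(LBINT u:A. 2 * c * (g u - f u) - c\<^sup>2 * f u) \<le> (LBINT u:A. (g u - f u)\<^sup>2 / f u)"
  proof (rule set_integral_mono)
    show "set_integrable lborel A (\<lambda>u. 2 * c * (g u - f u) - c\<^sup>2 * f u)"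
      by (intro set_integral_diff set_integrable_mult_right) (use f g in auto)
    fix u assume "u \<in> A"
    then have fu: "0 < f u" by (rule pos)
    have "0 \<le> ((g u - f u) - c * f u)\<^sup>2 / f u" using fu by simp
    also have "\<dots> = (g u - f u)\<^sup>2 / f u - 2 * c * (g u - f u) + c\<^sup>2 * f u"
      using fu by (simp add: power2_eq_square field_simps)
    finally show "2 * c * (g u - f u) - c\<^sup>2 * f u \<le> (g u - f u)\<^sup>2 / f u" by simp
  qed (rule h)
  also have "(LBINT u:A. 2 * c * (g u - f u) - c\<^sup>2 * f u) = 2 * c * (?b - ?a) - c\<^sup>2 * ?a"
    using f g by (simp add: set_integral_diff)
  also have "\<dots> = (?b - ?a)\<^sup>2 / ?a"
    using a by (simp add: c_def power2_eq_square field_simps)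
  finally show ?thesis .
qed

lemma prob_space_sample_law:
  assumes S: "poisson_sample M \<tau> lam n X" and "1 \<le> n"
  shows "prob_space (sample_law M \<tau> n X)"
proof -
  have pp: "poisson_process M \<tau> lam (X j)" if "j \<in> {1..n}" for j
    using S that by (simp add: poisson_sample_def)
  interpret prob_space M
    using pp[of 1] \<open>1 \<le> n\<close> by (auto simp: poisson_process_def)
  show ?thesis
    unfolding sample_law_def sample_space_def
    using pp by (intro prob_space_distr measurable_restrict) (auto intro: poisson_process.measurable_path)
qed

lemma sets_sample_law: "sets (sample_law M \<tau> n X) = sets (sample_space \<tau> n)"
  by (simp add: sample_law_def)

text \<open>
  For every grid the second moment of the likelihood ratio of the increments is
  \<open>exp (n * \<Sum>i. (b i - a i)\<^sup>2 / a i)\<close>, where \<open>a i\<close> and \<open>b i\<close> are the integrals of the intensities over the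
  grid intervals.  The sum is at most the integral of \<open>(lam1 - lam0)\<^sup>2 / lam0\<close>, whatever the grid, and
  a bound that is uniform in the grid passes to all statistics.
\<close>

lemma sample_law_expectation_diff:
  fixes f :: "(nat \<Rightarrow> real \<Rightarrow> nat) \<Rightarrow> real"
  assumes S0: "poisson_sample M0 \<tau> lam0 n X0" and S1: "poisson_sample M1 \<tau> lam1 n X1"
    and n: "1 \<le> n" and \<tau>: "0 < \<tau>" and m: "0 < m"
    and lam0: "\<And>t. t \<in> {0..\<tau>} \<Longrightarrow> m \<le> lam0 t" and lam1: "\<And>t. t \<in> {0..\<tau>} \<Longrightarrow> m \<le> lam1 t"
    and h: "set_integrable lborel {0..\<tau>} (\<lambda>u. (lam1 u - lam0 u)\<^sup>2 / lam0 u)"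
    and D: "real n * (LBINT u:{0..\<tau>}. (lam1 u - lam0 u)\<^sup>2 / lam0 u) \<le> D"
    and f: "f \<in> borel_measurable (sample_space \<tau> n)" and bnd: "\<And>x. \<bar>f x\<bar> \<le> B"
  defines "P \<equiv> sample_law M0 \<tau> n X0" and "Q \<equiv> sample_law M1 \<tau> n X1"
  shows "\<bar>(\<integral>x. f x \<partial>Q) - (\<integral>x. f x \<partial>P)\<bar> \<le> sqrt (exp D - 1) * sqrt (\<integral>x. (f x)\<^sup>2 \<partial>P)"
proof -
  have int: "set_integrable lborel {0..\<tau>} lam0" "set_integrable lborel {0..\<tau>} lam1"
    using S0 S1 n by (auto simp: poisson_sample_def dest!: bspec[of _ _ 1] intro: poisson_process.intensity_integrable)
  have P: "prob_space P" "sets P = sets (sample_space \<tau> n)" and Q: "prob_space Q" "sets Q = sets (sample_space \<tau> n)"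
    using prob_space_sample_law[OF S0 n] prob_space_sample_law[OF S1 n] by (simp_all add: P_def Q_def sets_sample_law)
  have "0 \<le> (LBINT u:{0..\<tau>}. (lam1 u - lam0 u)\<^sup>2 / lam0 u)"
    unfolding set_lebesgue_integral_def
  proof (rule integral_nonneg_AE, rule AE_I2)
    fix u
    show "0 \<le> indicat_real {0..\<tau>} u *\<^sub>R ((lam1 u - lam0 u)\<^sup>2 / lam0 u)"
      using lam0[of u] m by (auto simp: indicator_def)
  qed
  then have D0: "0 \<le> D" using D by (metis mult_nonneg_nonneg of_nat_0_le_iff order_trans)
  show ?thesis
  proof (rule expectation_diff_extends_from_directed_subalgebras
      [where M="sample_space \<tau> n" and G="increment_algebra \<tau> n" and I="grids \<tau>", OF P Q])
    show "grids \<tau> \<noteq> {}" using \<tau> by (auto simp: grids_def intro!: exI[of _ "{0, \<tau>}"])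
    show "\<exists>L\<in>grids \<tau>. sets (increment_algebra \<tau> n J) \<union> sets (increment_algebra \<tau> n K) \<subseteq> sets (increment_algebra \<tau> n L)"
      if "J \<in> grids \<tau>" "K \<in> grids \<tau>" for J K
    proof
      show L: "J \<union> K \<in> grids \<tau>" using that by (auto simp: grids_def)
      show "sets (increment_algebra \<tau> n J) \<union> sets (increment_algebra \<tau> n K) \<subseteq> sets (increment_algebra \<tau> n (J \<union> K))"
        using increment_algebra_mono[OF that(1) L _ \<tau>] increment_algebra_mono[OF that(2) L _ \<tau>] by (intro Un_least) auto
    qed
    show "space (increment_algebra \<tau> n J) = space (sample_space \<tau> n)" for J
      by (simp add: increment_algebra_def)
    show "sets (increment_algebra \<tau> n J) \<subseteq> sets (sample_space \<tau> n)" if "J \<in> grids \<tau>" for J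
      by (rule sets_increment_algebra_subset[OF that \<tau>])
    show "sets (sample_space \<tau> n) \<subseteq>
        sigma_sets (space (sample_space \<tau> n)) (\<Union>J\<in>grids \<tau>. sets (increment_algebra \<tau> n J))"
      by (rule sets_sample_space_generated[OF \<tau>])
    show "0 \<le> sqrt (exp D - 1)" using D0 by simp
  next
    fix J and g :: "(nat \<Rightarrow> real \<Rightarrow> nat) \<Rightarrow> real" and C
    assume J: "J \<in> grids \<tau>" and g: "g \<in> borel_measurable (increment_algebra \<tau> n J)" and C: "\<And>x. \<bar>g x\<bar> \<le> C"
    note gp = grid_point_props[OF J \<tau>]
    let ?k = "card J - 1" and ?G = "increment_algebra \<tau> n J"
    define a where "a i = (LBINT u:{grid_point J i..grid_point J (Suc i)}. lam0 u)" for i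
    define b where "b i = (LBINT u:{grid_point J i..grid_point J (Suc i)}. lam1 u)" for i
    have sub: "{grid_point J i..grid_point J (Suc i)} \<subseteq> {0..\<tau>}" if "i < ?k" for i
      using grid_point_in_range[OF J \<tau>, of i] grid_point_in_range[OF J \<tau>, of "Suc i"] that by auto
    have less: "grid_point J i < grid_point J (Suc i)" if "i < ?k" for i
      using that by (intro strict_mono_onD[OF gp(1)]) auto
    have ints: "set_integrable lborel {grid_point J i..grid_point J (Suc i)} v"
      if "i < ?k" "set_integrable lborel {0..\<tau>} v" for i and v :: "real \<Rightarrow> real"
      by (rule set_integrable_subset[OF that(2) _ sub[OF that(1)]]) simp
    have pos: "0 < (LBINT u:{grid_point J i..grid_point J (Suc i)}. v u)"
      if i: "i < ?k" and v: "set_integrable lborel {0..\<tau>} v" "\<And>t. t \<in> {0..\<tau>} \<Longrightarrow> m \<le> v t" for i v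
    proof -
      have "0 < m * (grid_point J (Suc i) - grid_point J i)" using less[OF i] m by simp
      also have "\<dots> \<le> (LBINT u:{grid_point J i..grid_point J (Suc i)}. v u)"
        using sub[OF i] less[OF i] by (intro set_integral_lower_bound ints[OF i v(1)] v(2)) auto
      finally show ?thesis .
    qed
    have ab: "0 < a i" "0 < b i" if "i < ?k" for i
      using pos[OF that int(1) lam0] pos[OF that int(2) lam1] by (auto simp: a_def b_def)
    have "(\<Sum>i<?k. (b i - a i)\<^sup>2 / a i) \<le>
        (\<Sum>i<?k. LBINT u:{grid_point J i..grid_point J (Suc i)}. (lam1 u - lam0 u)\<^sup>2 / lam0 u)"
    proof (rule sum_mono)
      fix i assume "i \<in> {..<?k}"
      then have i: "i < ?k" by simp
      have "0 < lam0 u" if "u \<in> {grid_point J i..grid_point J (Suc i)}" for u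
        using lam0[of u] m sub[OF i] that by auto
      then show "(b i - a i)\<^sup>2 / a i \<le> (LBINT u:{grid_point J i..grid_point J (Suc i)}. (lam1 u - lam0 u)\<^sup>2 / lam0 u)"
        using ab(1)[OF i] unfolding a_def b_def
        by (intro squared_increment_le_integral ints[OF i] int h)
    qed
    also have "\<dots> = (LBINT u:{0..\<tau>}. (lam1 u - lam0 u)\<^sup>2 / lam0 u)"
      by (rule set_integral_grid_sum[OF J \<tau> h])
    finally have "real n * (\<Sum>i<?k. (b i - a i)\<^sup>2 / a i) \<le> D"
      using D by (meson mult_left_mono of_nat_0_le_iff order_trans)
    moreover have "(\<Prod>j\<in>{1..n}. \<Prod>i<?k. exp ((b i - a i)\<^sup>2 / a i)) = exp (real n * (\<Sum>i<?k. (b i - a i)\<^sup>2 / a i))"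
      by (simp add: exp_sum exp_of_nat_mult)
    ultimately have le: "(\<Prod>j\<in>{1..n}. \<Prod>i<?k. exp ((b i - a i)\<^sup>2 / a i)) \<le> exp D" by simp
    have "second_moment_le (\<Prod>j\<in>{1..n}. \<Prod>i<?k. exp ((b i - a i)\<^sup>2 / a i))
        (PiM {1..n} (\<lambda>_. PiM {..<?k} (\<lambda>i. measure_pmf (poisson_pmf (a i)))))
        (PiM {1..n} (\<lambda>_. PiM {..<?k} (\<lambda>i. measure_pmf (poisson_pmf (b i)))))"
      by (intro second_moment_le_PiM second_moment_le_poisson prob_space_PiM prod_nonneg measure_pmf.prob_space_axioms)
        (auto simp: ab)
    also have "PiM {1..n} (\<lambda>_. PiM {..<?k} (\<lambda>i. measure_pmf (poisson_pmf (a i)))) =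
        distr P (increment_space n J) (increments n J)"
      unfolding P_def a_def using ab(1) by (intro distr_increments_sample_law[OF S0 n J \<tau>, symmetric]) (simp add: a_def)
    also have "PiM {1..n} (\<lambda>_. PiM {..<?k} (\<lambda>i. measure_pmf (poisson_pmf (b i)))) =
        distr Q (increment_space n J) (increments n J)"
      unfolding Q_def b_def using ab(2) by (intro distr_increments_sample_law[OF S1 n J \<tau>, symmetric]) (simp add: b_def)
    finally have sm: "second_moment_le (exp D) (distr P (increment_space n J) (increments n J))
        (distr Q (increment_space n J) (increments n J))"
      using le by (rule second_moment_le_mono)
    have mP: "increments n J \<in> P \<rightarrow>\<^sub>M increment_space n J"
      using measurable_increments_sample_space[OF J \<tau>] P(2) by (simp cong: measurable_cong_sets)
    have mQ: "increments n J \<in> Q \<rightarrow>\<^sub>M increment_space n J"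
      using measurable_increments_sample_space[OF J \<tau>] Q(2) by (simp cong: measurable_cong_sets)
    have sp: "space Q = space P"
      using P(2) Q(2) by (intro sets_eq_imp_space_eq) simp
    have G: "?G = vimage_algebra (space P) (increments n J) (increment_space n J)"
      using sets_eq_imp_space_eq[OF P(2)] by (simp add: increment_algebra_def)
    have smG: "second_moment_le (exp D) (distr P ?G (\<lambda>x. x)) (distr Q ?G (\<lambda>x. x))"
      unfolding G by (rule second_moment_le_vimage_algebra[OF mP _ sm]) (simp add: P Q)
    have id: "(\<lambda>x. x) \<in> P \<rightarrow>\<^sub>M ?G" "(\<lambda>x. x) \<in> Q \<rightarrow>\<^sub>M ?G"
      unfolding G using mP mQ sp by (auto intro!: measurable_vimage_algebra2)
    have "\<bar>(\<integral>x. g x \<partial>distr Q ?G (\<lambda>x. x)) - (\<integral>x. g x \<partial>distr P ?G (\<lambda>x. x))\<bar> \<le>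
        sqrt (exp D - 1) * sqrt (\<integral>x. (g x)\<^sup>2 \<partial>distr P ?G (\<lambda>x. x))"
      using g C id by (intro second_moment_le_expectation_diff[OF _ _ _ smG, of g C] prob_space.prob_space_distr P Q) auto
    then show "\<bar>(\<integral>x. g x \<partial>Q) - (\<integral>x. g x \<partial>P)\<bar> \<le> sqrt (exp D - 1) * sqrt (\<integral>x. (g x)\<^sup>2 \<partial>P)"
      using g id by (simp add: integral_distr)
  qed (use f bnd in auto)
qed

section \<open>Risk and bias along an arithmetic progression\<close>

text \<open>
  The Cramer-Rao argument in finite form.  If the risk is at most \<open>R\<close>, then the bias of \<open>S\<close> is at most
  \<open>sqrt R\<close> at both ends of the arithmetic progression, so the expectation of \<open>S\<close> has to grow by at
  least \<open>N * u - 2 * sqrt R\<close> along it.  But between two neighbours it grows by at most \<open>K * sqrt R\<close>: the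
  assumption on neighbours, applied to \<open>S - \<theta>\<close>, bounds this growth by \<open>K\<close> times the root of the risk.
\<close>

lemma bias_telescoping_bound:
  fixes P :: "nat \<Rightarrow> 'a measure" and S :: "'a \<Rightarrow> real" and \<theta>\<^sub>0 u K R :: real
  assumes P: "\<And>k. k \<le> N \<Longrightarrow> prob_space (P k)" "\<And>k. k \<le> N \<Longrightarrow> sets (P k) = sets M"
    and S: "S \<in> borel_measurable M" and u: "0 \<le> u" and K: "0 \<le> K" and R: "0 \<le> R"
    and risk: "\<And>k. k \<le> N \<Longrightarrow> (\<integral>\<^sup>+x. ennreal ((S x - (\<theta>\<^sub>0 + real k * u))\<^sup>2) \<partial>P k) \<le> ennreal R"
    and diff: "\<And>k f B. k < N \<Longrightarrow> f \<in> borel_measurable M \<Longrightarrow> (\<And>x. \<bar>f x\<bar> \<le> (B::real)) \<Longrightarrow>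
      \<bar>(\<integral>x. f x \<partial>P k) - (\<integral>x. f x \<partial>P (Suc k))\<bar> \<le> K * sqrt (\<integral>x. (f x)\<^sup>2 \<partial>P (Suc k))"
  shows "real N * u \<le> sqrt R * (2 + real N * K)"
proof -
  define \<theta> where "\<theta> k = \<theta>\<^sub>0 + real k * u" for k
  \<comment> \<open>truncation to the range of the parameter does not increase the risk, and makes the estimator bounded\<close>
  define T where "T x = max \<theta>\<^sub>0 (min (\<theta> N) (S x))" for x
  define B where "B = \<bar>\<theta>\<^sub>0\<bar> + \<bar>\<theta> N\<bar>"
  have Tm: "T \<in> borel_measurable M" unfolding T_def using S by measurable
  have \<theta>: "\<theta>\<^sub>0 \<le> \<theta> k" "\<theta> k \<le> \<theta> N" if "k \<le> N" for k
    using u that by (auto simp: \<theta>_def intro: mult_right_mono)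
  have Tb: "\<bar>T x\<bar> \<le> B" for x using \<theta>[of 0] by (auto simp: T_def B_def)
  have Tdb: "\<bar>T x - \<theta> k\<bar> \<le> B + \<bar>\<theta> k\<bar>" for x k using Tb[of x] by linarith
  have mk: "borel_measurable (P k) = (borel_measurable M :: ('a \<Rightarrow> real) set)" if "k \<le> N" for k
    using P(2)[OF that] by (simp cong: measurable_cong_sets)
  have int: "integrable (P k) f" if "k \<le> N" "f \<in> borel_measurable M" "\<And>x. \<bar>f x\<bar> \<le> C" for f k and C :: real
  proof -
    interpret prob_space "P k" by (rule P(1)[OF that(1)])
    show ?thesis
      by (rule integrable_const_bound[of _ C]) (simp_all add: that mk[OF that(1)])
  qed
  have int2: "integrable (P k) (\<lambda>x. (T x - \<theta> k)\<^sup>2)" if k: "k \<le> N" for k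
  proof (rule int[OF k])
    show "(\<lambda>x. (T x - \<theta> k)\<^sup>2) \<in> borel_measurable M" using Tm by measurable
    show "\<bar>(T x - \<theta> k)\<^sup>2\<bar> \<le> (B + \<bar>\<theta> k\<bar>)\<^sup>2" for x
      using power_mono[OF Tdb[of x k] abs_ge_zero, where n = 2] by simp
  qed
  have risk': "(\<integral>x. (T x - \<theta> k)\<^sup>2 \<partial>P k) \<le> R" if k: "k \<le> N" for k
  proof -
    have "\<bar>T x - \<theta> k\<bar> \<le> \<bar>S x - \<theta> k\<bar>" for x
      using \<theta>[OF k] unfolding T_def by linarith
    then have le: "(T x - \<theta> k)\<^sup>2 \<le> (S x - \<theta> k)\<^sup>2" for x
      by (simp add: abs_le_square_iff)
    have "ennreal (\<integral>x. (T x - \<theta> k)\<^sup>2 \<partial>P k) = (\<integral>\<^sup>+x. ennreal ((T x - \<theta> k)\<^sup>2) \<partial>P k)"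
      using int2[OF k] by (intro nn_integral_eq_integral[symmetric]) simp_all
    also have "\<dots> \<le> (\<integral>\<^sup>+x. ennreal ((S x - (\<theta>\<^sub>0 + real k * u))\<^sup>2) \<partial>P k)"
      using le by (intro nn_integral_mono ennreal_leI) (simp add: \<theta>_def)
    also have "\<dots> \<le> ennreal R" by (rule risk[OF k])
    finally show ?thesis using R by simp
  qed
  have bias: "\<bar>(\<integral>x. T x \<partial>P k) - \<theta> k\<bar> \<le> sqrt R" if k: "k \<le> N" for k
  proof -
    interpret prob_space "P k" by (rule P(1)[OF k])
    have i: "integrable (P k) T" using int[OF k Tm Tb] .
    note i2 = int2[OF k]
    have i1: "integrable (P k) (\<lambda>x. T x - \<theta> k)" using i by simp
    have "(expectation (\<lambda>x. T x - \<theta> k))\<^sup>2 \<le> expectation (\<lambda>x. (T x - \<theta> k)\<^sup>2)"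
      using variance_positive[of "\<lambda>x. T x - \<theta> k"] unfolding variance_eq[OF i1 i2] by linarith
    with risk'[OF k] have "(expectation (\<lambda>x. T x - \<theta> k))\<^sup>2 \<le> R" by linarith
    then have "\<bar>expectation (\<lambda>x. T x - \<theta> k)\<bar> \<le> sqrt R" 
      using real_sqrt_le_mono by fastforce
    then show ?thesis using i by (simp add: prob_space)
  qed
  have step: "(\<integral>x. T x \<partial>P (Suc k)) - (\<integral>x. T x \<partial>P k) \<le> sqrt R * K" if k: "k < N" for k
  proof -
    have "\<bar>(\<integral>x. T x - \<theta> (Suc k) \<partial>P k) - (\<integral>x. T x - \<theta> (Suc k) \<partial>P (Suc k))\<bar> \<le>
        K * sqrt (\<integral>x. (T x - \<theta> (Suc k))\<^sup>2 \<partial>P (Suc k))"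
      by (rule diff[OF k _ Tdb]) (use Tm in measurable)
    also have "\<dots> \<le> K * sqrt R"
      using risk'[of "Suc k"] k K by (intro mult_left_mono) auto
    finally have "\<bar>(\<integral>x. T x - \<theta> (Suc k) \<partial>P k) - (\<integral>x. T x - \<theta> (Suc k) \<partial>P (Suc k))\<bar> \<le> K * sqrt R" .
    moreover have "(\<integral>x. T x - \<theta> (Suc k) \<partial>P i) = (\<integral>x. T x \<partial>P i) - \<theta> (Suc k)" if "i \<le> N" for i
    proof -
      interpret prob_space "P i" by (rule P(1)[OF that])
      show ?thesis using int[OF that Tm Tb] by (simp add: prob_space)
    qed
    ultimately show ?thesis using k by (simp add: mult.commute)
  qed
  have "n \<le> N \<Longrightarrow> (\<integral>x. T x \<partial>P n) - (\<integral>x. T x \<partial>P 0) \<le> real n * (sqrt R * K)" for n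
  proof (induction n)
    case (Suc n)
    then show ?case using step[of n] by (simp add: algebra_simps)
  qed simp
  from this[of N] bias[of N] bias[of 0] show ?thesis
    by (simp add: \<theta>_def algebra_simps)
qed

section \<open>The intensities with a ramp\<close>

definition ramp :: "real \<Rightarrow> real" where
  "ramp x = max 0 (min 1 x)"

lemma ramp_bounds: "0 \<le> ramp x" "ramp x \<le> 1"
  by (auto simp: ramp_def)

text \<open>
  In this form it is visible that the intensity is continuous in \<open>t\<close>, depends on \<open>\<theta>\<close> in a Lipschitz way
  with constant \<open>\<bar>r\<bar> / d\<close>, and lies between \<open>\<psi>\<close> and \<open>\<psi> + r\<close>.
\<close>

lemma intensity_eq_ramp:
  assumes "0 < d" "t \<le> \<tau>"
  shows "intensity \<psi> r \<tau> d \<theta> t = \<psi> t + r * ramp ((t - \<theta>) / d)"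
proof -
  consider "t < \<theta>" | "\<theta> \<le> t" "t < \<theta> + d" | "\<theta> + d \<le> t" by linarith
  then show ?thesis
  proof cases
    case 1
    then have "(t - \<theta>) / d < 0" using assms by (simp add: field_simps)
    then show ?thesis using 1 assms by (simp add: intensity_def ramp_def)
  next
    case 2
    then have "0 \<le> (t - \<theta>) / d" "(t - \<theta>) / d \<le> 1" using assms by (auto simp: field_simps)
    then show ?thesis using 2 by (simp add: intensity_def ramp_def)
  next
    case 3
    then have "1 \<le> (t - \<theta>) / d" using assms by (simp add: field_simps)
    then show ?thesis using 3 assms by (simp add: intensity_def ramp_def)
  qed
qed

lemma ramp_mix_lower_bound:
  assumes "m \<le> (y::real)" "m \<le> y + r"
  shows "m \<le> y + r * ramp x"
proof -
  have "y + r * ramp x = (1 - ramp x) * y + ramp x * (y + r)" by (simp add: algebra_simps)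
  also have "\<dots> \<ge> (1 - ramp x) * m + ramp x * m"
    using ramp_bounds[of x] assms by (intro add_mono mult_left_mono) auto
  finally show ?thesis by (simp add: algebra_simps)
qed

lemma set_integral_inverse_affine:
  fixes r d p \<theta> :: real
  assumes "r \<noteq> 0" "0 < d" "0 < p" "0 < p + r"
  shows "set_integrable lborel {\<theta>..\<theta> + d} (\<lambda>t. 1 / (p + r * ((t - \<theta>) / d)))"
    and "(LBINT t:{\<theta>..\<theta> + d}. 1 / (p + r * ((t - \<theta>) / d))) = d / r * ln ((p + r) / p)"
proof -
  have pos: "0 < p + r * ((t - \<theta>) / d)" if "t \<in> {\<theta>..\<theta> + d}" for t
  proof -
    have "(t - \<theta>) / d = ramp ((t - \<theta>) / d)" using that \<open>0 < d\<close> by (auto simp: ramp_def field_simps)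
    moreover have "min p (p + r) \<le> p + r * ramp ((t - \<theta>) / d)" by (rule ramp_mix_lower_bound) auto
    ultimately show ?thesis using assms by auto
  qed
  have cont: "continuous_on {\<theta>..\<theta> + d} (\<lambda>t. 1 / (p + r * ((t - \<theta>) / d)))"
    using pos \<open>0 < d\<close> by (intro continuous_intros) (auto simp: less_imp_neq[symmetric])
  then show "set_integrable lborel {\<theta>..\<theta> + d} (\<lambda>t. 1 / (p + r * ((t - \<theta>) / d)))"
    by (rule borel_integrable_atLeastAtMost')
  have "(LBINT t:{\<theta>..\<theta> + d}. 1 / (p + r * ((t - \<theta>) / d))) =
      d / r * ln (p + r * ((\<theta> + d - \<theta>) / d)) - d / r * ln (p + r * ((\<theta> - \<theta>) / d))"
    unfolding set_lebesgue_integral_def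
  proof (rule integral_FTC_atLeastAtMost[where F="\<lambda>t. d / r * ln (p + r * ((t - \<theta>) / d))"])
    fix t assume "\<theta> \<le> t" "t \<le> \<theta> + d"
    then have "0 < p + r * ((t - \<theta>) / d)" using pos by simp
    then have "((\<lambda>t. d / r * ln (p + r * ((t - \<theta>) / d))) has_real_derivative
        d / r * ((r * (1 / d)) * (1 / (p + r * ((t - \<theta>) / d))))) (at t within {\<theta>..\<theta> + d})"
      using assms by (auto intro!: derivative_eq_intros)
    then show "((\<lambda>t. d / r * ln (p + r * ((t - \<theta>) / d))) has_vector_derivative
        1 / (p + r * ((t - \<theta>) / d))) (at t within {\<theta>..\<theta> + d})"
      using assms by (simp add: has_real_derivative_iff_has_vector_derivative)
  qed (use cont \<open>0 < d\<close> in auto)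
  also have "\<dots> = d / r * (ln (p + r) - ln p)"
    using assms by (simp add: right_diff_distrib)
  finally show "(LBINT t:{\<theta>..\<theta> + d}. 1 / (p + r * ((t - \<theta>) / d))) = d / r * ln ((p + r) / p)"
    using assms by (simp add: ln_div)
qed

text \<open>
  The two intensities differ by at most \<open>\<bar>r\<bar> * u / d\<close>, and only on \<open>[\<theta> - u, \<theta> + d]\<close>.  On \<open>[\<theta> - u, \<theta>]\<close> the
  denominator is \<open>\<psi> \<ge> p\<close>, on \<open>[\<theta>, \<theta> + d]\<close> it is at least \<open>p + r * (t - \<theta>) / d\<close>, and the logarithm is the
  integral of the reciprocal of the latter.
\<close>

lemma intensity_chi_square_bound:
  assumes \<psi>: "continuous_on {0..\<tau>} \<psi>" and m: "0 < m" "\<And>t. t \<in> {0..\<tau>} \<Longrightarrow> m \<le> \<psi> t" "\<And>t. t \<in> {0..\<tau>} \<Longrightarrow> m \<le> \<psi> t + r"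
    and r: "r \<noteq> 0" and d: "0 < d" and u: "0 \<le> u" and p: "0 < p" "0 < p + r"
    and loc: "\<And>t. t \<in> {\<theta> - u..\<theta> + d} \<Longrightarrow> t \<in> {0..\<tau>} \<Longrightarrow> p \<le> \<psi> t"
  defines "g \<equiv> \<lambda>t. (intensity \<psi> r \<tau> d (\<theta> - u) t - intensity \<psi> r \<tau> d \<theta> t)\<^sup>2 / intensity \<psi> r \<tau> d \<theta> t"
  shows "set_integrable lborel {0..\<tau>} g"
    and "(LBINT t:{0..\<tau>}. g t) \<le> (r * u / d)\<^sup>2 * (u / p + d / r * ln ((p + r) / p))"
proof -
  let ?I = "\<lambda>\<theta> t. \<psi> t + r * ramp ((t - \<theta>) / d)"
  have I_ge: "m \<le> ?I \<theta> t" if "t \<in> {0..\<tau>}" for t \<theta>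
    using that m by (intro ramp_mix_lower_bound) auto
  have geq: "g t = (?I (\<theta> - u) t - ?I \<theta> t)\<^sup>2 / ?I \<theta> t" if "t \<in> {0..\<tau>}" for t
    using that d unfolding g_def by (simp add: intensity_eq_ramp)
  have contI: "continuous_on {0..\<tau>} (?I \<theta>)" for \<theta>
    using d unfolding ramp_def by (intro continuous_intros \<psi>) auto
  have ne: "?I \<theta> t \<noteq> 0" if "t \<in> {0..\<tau>}" for t
    using I_ge[OF that, of \<theta>] m(1) by linarith
  have "continuous_on {0..\<tau>} (\<lambda>t. (?I (\<theta> - u) t - ?I \<theta> t)\<^sup>2 / ?I \<theta> t)"
    by (intro continuous_on_divide continuous_on_power continuous_on_diff contI) (use ne in auto)
  then have "continuous_on {0..\<tau>} g"
    by (rule continuous_on_eq) (simp add: geq)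
  then show int: "set_integrable lborel {0..\<tau>} g"
    by (rule borel_integrable_atLeastAtMost')
  define q where "q t = 1 / (p + r * ((t - \<theta>) / d))" for t
  define c where "c = (r * u / d)\<^sup>2"
  have int_q: "integrable lborel (\<lambda>t. indicat_real {\<theta>..\<theta> + d} t *\<^sub>R q t)"
    using set_integral_inverse_affine(1)[OF r d p, of \<theta>] by (simp add: q_def set_integrable_def)
  have int_1: "integrable lborel (indicat_real {\<theta> - u..\<theta>})"
    using u by (intro integrable_real_indicator) auto
  have int_b: "integrable lborel (\<lambda>t. c * (indicat_real {\<theta> - u..\<theta>} t * (1 / p) + indicat_real {\<theta>..\<theta> + d} t *\<^sub>R q t))"
    by (intro integrable_mult_right Bochner_Integration.integrable_add int_q integrable_mult_left int_1)
  have "(LBINT t:{0..\<tau>}. g t) \<le>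
      (LBINT t. c * (indicat_real {\<theta> - u..\<theta>} t * (1 / p) + indicat_real {\<theta>..\<theta> + d} t *\<^sub>R q t))"
    unfolding set_lebesgue_integral_def
  proof (rule integral_mono)
    show "integrable lborel (\<lambda>t. indicat_real {0..\<tau>} t *\<^sub>R g t)"
      using int by (simp add: set_integrable_def)
    fix t :: real
    have q0: "0 \<le> indicat_real {\<theta>..\<theta> + d} t *\<^sub>R q t"
    proof (cases "t \<in> {\<theta>..\<theta> + d}")
      case True
      then have "(t - \<theta>) / d = ramp ((t - \<theta>) / d)" using d by (auto simp: ramp_def field_simps)
      moreover have "min p (p + r) \<le> p + r * ramp ((t - \<theta>) / d)" by (rule ramp_mix_lower_bound) auto
      ultimately show ?thesis using p by (auto simp: q_def)
    qed auto
    have rhs0: "0 \<le> c * (indicat_real {\<theta> - u..\<theta>} t * (1 / p) + indicat_real {\<theta>..\<theta> + d} t *\<^sub>R q t)"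
      using q0 p by (auto simp: c_def intro!: mult_nonneg_nonneg add_nonneg_nonneg)
    show "indicat_real {0..\<tau>} t *\<^sub>R g t \<le>
        c * (indicat_real {\<theta> - u..\<theta>} t * (1 / p) + indicat_real {\<theta>..\<theta> + d} t *\<^sub>R q t)"
    proof (cases "t \<in> {0..\<tau>} \<and> t \<in> {\<theta> - u..\<theta> + d}")
      case False
      have "g t = 0" if "t \<in> {0..\<tau>}"
      proof -
        have "t < \<theta> - u \<or> \<theta> + d < t" using False that by auto
        then have "ramp ((t - (\<theta> - u)) / d) = ramp ((t - \<theta>) / d)"
        proof
          assume "t < \<theta> - u"
          then have "(t - (\<theta> - u)) / d < 0" "(t - \<theta>) / d < 0"
            using d u by (auto simp: divide_neg_pos)
          then show ?thesis by (simp add: ramp_def)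
        next
          assume "\<theta> + d < t"
          then have "1 \<le> (t - (\<theta> - u)) / d" "1 \<le> (t - \<theta>) / d" using d u by (auto simp: field_simps)
          then show ?thesis by (simp add: ramp_def)
        qed
        then show ?thesis using geq[OF that] by simp
      qed
      then show ?thesis using rhs0 by (cases "t \<in> {0..\<tau>}") auto
    next
      case True
      have \<psi>p: "p \<le> \<psi> t" using loc True by blast
      have lip: "\<bar>ramp ((t - (\<theta> - u)) / d) - ramp ((t - \<theta>) / d)\<bar> \<le> u / d"
      proof -
        have "\<bar>ramp x - ramp y\<bar> \<le> \<bar>x - y\<bar>" for x y by (auto simp: ramp_def)
        from this[of "(t - (\<theta> - u)) / d" "(t - \<theta>) / d"]
        show ?thesis using u d by (simp add: diff_divide_distrib[symmetric])
      qed
      have "\<bar>?I (\<theta> - u) t - ?I \<theta> t\<bar> = \<bar>r\<bar> * \<bar>ramp ((t - (\<theta> - u)) / d) - ramp ((t - \<theta>) / d)\<bar>"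
        by (simp add: abs_mult[symmetric] right_diff_distrib)
      also have "\<dots> \<le> \<bar>r\<bar> * (u / d)" by (intro mult_left_mono lip) auto
      also have "\<dots> = \<bar>r * u / d\<bar>" using u d by (simp add: abs_mult)
      finally have num: "(?I (\<theta> - u) t - ?I \<theta> t)\<^sup>2 \<le> c"
        unfolding c_def abs_le_square_iff .
      have Ipos: "0 < ?I \<theta> t" using I_ge[of t \<theta>] True m(1) by auto
      have inv: "1 / ?I \<theta> t \<le> indicat_real {\<theta> - u..\<theta>} t * (1 / p) + indicat_real {\<theta>..\<theta> + d} t *\<^sub>R q t"
      proof (cases "t \<le> \<theta>")
        case t: True
        then have "ramp ((t - \<theta>) / d) = 0" using d by (auto simp: ramp_def divide_nonpos_pos)
        then have "1 / ?I \<theta> t \<le> 1 / p" using \<psi>p p by (simp add: frac_le)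
        then show ?thesis using t True q0 by simp
      next
        case t: False
        then have "ramp ((t - \<theta>) / d) = (t - \<theta>) / d" using d True by (auto simp: ramp_def field_simps)
        moreover have "0 < p + r * ramp ((t - \<theta>) / d)"
          using ramp_mix_lower_bound[of "min p (p + r)" p r "(t - \<theta>) / d"] p by auto
        ultimately have "1 / ?I \<theta> t \<le> q t" unfolding q_def using \<psi>p by (intro frac_le) auto
        then show ?thesis using t True by simp
      qed
      have "g t = (?I (\<theta> - u) t - ?I \<theta> t)\<^sup>2 * (1 / ?I \<theta> t)" using geq True by simp
      also have "\<dots> \<le> c * (indicat_real {\<theta> - u..\<theta>} t * (1 / p) + indicat_real {\<theta>..\<theta> + d} t *\<^sub>R q t)"
        using num inv Ipos by (intro mult_mono) (auto simp: c_def)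
      finally show ?thesis using True by simp
    qed
  qed (rule int_b)
  also have "\<dots> = c * (u * (1 / p) + (LBINT t:{\<theta>..\<theta> + d}. q t))"
  proof -
    have "(LBINT t. indicat_real {\<theta> - u..\<theta>} t * (1 / p) + indicat_real {\<theta>..\<theta> + d} t *\<^sub>R q t) =
        (LBINT t. indicat_real {\<theta> - u..\<theta>} t * (1 / p)) + (LBINT t. indicat_real {\<theta>..\<theta> + d} t *\<^sub>R q t)"
      by (intro Bochner_Integration.integral_add integrable_mult_left int_1 int_q)
    also have "(LBINT t. indicat_real {\<theta> - u..\<theta>} t * (1 / p)) = u * (1 / p)"
      using u by simp
    finally show ?thesis
      by (simp only: set_lebesgue_integral_def Bochner_Integration.integral_mult_right_zero)
  qed
  also have "\<dots> = (r * u / d)\<^sup>2 * (u / p + d / r * ln ((p + r) / p))"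
    using set_integral_inverse_affine(2)[OF r d p, of \<theta>] by (simp add: c_def q_def)
  finally show "(LBINT t:{0..\<tau>}. g t) \<le> (r * u / d)\<^sup>2 * (u / p + d / r * ln ((p + r) / p))" .
qed

lemma fisher_information_pos:
  assumes "0 < y" "0 < y + r" "r \<noteq> (0::real)"
  shows "0 < r * ln ((y + r) / y)"
proof (cases "0 < r")
  case True
  then show ?thesis using assms by (intro mult_pos_pos ln_gt_zero) auto
next
  case False
  then have "r < 0" "ln ((y + r) / y) < 0" using assms by (auto intro!: ln_less_zero simp: divide_less_eq)
  then show ?thesis by (simp add: mult_neg_neg)
qed

text \<open>
  The bound \<open>(N * h / (2 + N * sqrt (exp (h\<^sup>2 * K) - 1)))\<^sup>2\<close> tends to \<open>1 / K\<close> if \<open>h\<close> tends to \<open>0\<close> and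
  \<open>N * h\<close> tends to infinity; here \<open>h = 1 / Suc i\<close> and \<open>N = (Suc i)\<^sup>2\<close>.
\<close>

lemma bias_bound_limit:
  assumes "0 < (K::real)"
  shows "(\<lambda>i. ((real (Suc i))\<^sup>2 * (1 / real (Suc i)) / (2 + (real (Suc i))\<^sup>2 * sqrt (exp ((1 / real (Suc i))\<^sup>2 * K) - 1)))\<^sup>2) \<longlonglongrightarrow> 1 / K"
proof -
  have "((\<lambda>x::real. (x\<^sup>2 * (1 / x) / (2 + x\<^sup>2 * sqrt (exp ((1 / x)\<^sup>2 * K) - 1)))\<^sup>2) \<longlongrightarrow> (inverse (K powr (1 / 2)))\<^sup>2) at_top"
    using assms by real_asymp
  moreover have "(inverse (K powr (1 / 2)))\<^sup>2 = 1 / K"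
    using assms by (simp add: powr_half_sqrt power_divide inverse_eq_divide)
  ultimately have "((\<lambda>x::real. (x\<^sup>2 * (1 / x) / (2 + x\<^sup>2 * sqrt (exp ((1 / x)\<^sup>2 * K) - 1)))\<^sup>2) \<longlongrightarrow> 1 / K) at_top"
    by simp
  then show ?thesis
    by (rule filterlim_compose) (intro filterlim_compose[OF filterlim_real_sequentially filterlim_Suc])
qed

section \<open>The asymptotic lower bound\<close>

text \<open>
  The neighbouring laws in the progression are compared with the larger parameter as the reference
  measure, since \<open>intensity_chi_square_bound\<close> estimates a shift to the left.
\<close>

lemma risk_bound_along_progression:
  fixes \<theta>\<^sub>0 u :: real and S :: "(nat \<Rightarrow> real \<Rightarrow> nat) \<Rightarrow> real"
  defines "\<theta> \<equiv> \<lambda>k. \<theta>\<^sub>0 + real k * u"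
  assumes n: "1 \<le> n" and \<tau>: "0 < \<tau>"
    and \<psi>: "continuous_on {0..\<tau>} \<psi>" and m: "0 < m" "\<And>t. t \<in> {0..\<tau>} \<Longrightarrow> m \<le> \<psi> t" "\<And>t. t \<in> {0..\<tau>} \<Longrightarrow> m \<le> \<psi> t + r"
    and r: "r \<noteq> 0" and d: "0 < d" and u: "0 \<le> u" and p: "0 < p" "0 < p + r"
    and sample: "\<And>k. k \<le> N \<Longrightarrow> poisson_sample (\<Omega> (\<theta> k)) \<tau> (intensity \<psi> r \<tau> d (\<theta> k)) n (X (\<theta> k))"
    and loc: "\<And>t. t \<in> {\<theta>\<^sub>0..\<theta> N + d} \<Longrightarrow> t \<in> {0..\<tau>} \<Longrightarrow> p \<le> \<psi> t"
    and D: "real n * ((r * u / d)\<^sup>2 * (u / p + d / r * ln ((p + r) / p))) \<le> D"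
    and S: "S \<in> borel_measurable (sample_space \<tau> n)" and R: "0 \<le> R"
    and risk: "\<And>k. k \<le> N \<Longrightarrow> quadratic_risk (sample_law (\<Omega> (\<theta> k)) \<tau> n (X (\<theta> k))) (\<theta> k) S \<le> ennreal R"
  shows "real N * u \<le> sqrt R * (2 + real N * sqrt (exp D - 1))"
proof -
  have r_lb: "m \<le> intensity \<psi> r \<tau> d \<theta>' t" if "t \<in> {0..\<tau>}" for \<theta>' t
    using that d m by (simp add: intensity_eq_ramp ramp_mix_lower_bound)
  have L: "0 < r * ln ((p + r) / p)" by (rule fisher_information_pos[OF p r])
  have "d / r * ln ((p + r) / p) = d * (r * ln ((p + r) / p)) / r\<^sup>2"
    using r by (simp add: power2_eq_square)
  also have "\<dots> \<ge> 0" using L d by (simp add: less_imp_le)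
  finally have "0 \<le> u / p + d / r * ln ((p + r) / p)"
    using u p by (intro add_nonneg_nonneg) auto
  then have "0 \<le> real n * ((r * u / d)\<^sup>2 * (u / p + d / r * ln ((p + r) / p)))"
    by (intro mult_nonneg_nonneg) auto
  then have D0: "0 \<le> D" using D by linarith
  show ?thesis
  proof (rule bias_telescoping_bound[where P="\<lambda>k. sample_law (\<Omega> (\<theta> k)) \<tau> n (X (\<theta> k))" and M="sample_space \<tau> n" and \<theta>\<^sub>0=\<theta>\<^sub>0])
    show "prob_space (sample_law (\<Omega> (\<theta> k)) \<tau> n (X (\<theta> k)))" if "k \<le> N" for k
      by (rule prob_space_sample_law[OF sample[OF that] n])
    show "(\<integral>\<^sup>+x. ennreal ((S x - (\<theta>\<^sub>0 + real k * u))\<^sup>2) \<partial>sample_law (\<Omega> (\<theta> k)) \<tau> n (X (\<theta> k))) \<le> ennreal R"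
      if "k \<le> N" for k
      using risk[OF that] by (simp add: quadratic_risk_def \<theta>_def)
    show "0 \<le> sqrt (exp D - 1)" using D0 by simp
  next
    fix k f and B :: real
    assume k: "k < N" and f: "f \<in> borel_measurable (sample_space \<tau> n)" and B: "\<And>x. \<bar>f x\<bar> \<le> B"
    have pred: "\<theta> (Suc k) - u = \<theta> k" by (simp add: \<theta>_def algebra_simps)
    have "\<theta>\<^sub>0 \<le> \<theta> k" using u by (simp add: \<theta>_def)
    moreover have "\<theta> (Suc k) \<le> \<theta> N"
      using u k unfolding \<theta>_def by (intro add_left_mono mult_right_mono) auto
    ultimately have loc': "p \<le> \<psi> t" if "t \<in> {\<theta> (Suc k) - u..\<theta> (Suc k) + d}" "t \<in> {0..\<tau>}" for t
      using that by (intro loc) (auto simp: pred)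
    have chi: "set_integrable lborel {0..\<tau>} (\<lambda>t. (intensity \<psi> r \<tau> d (\<theta> k) t - intensity \<psi> r \<tau> d (\<theta> (Suc k)) t)\<^sup>2 / intensity \<psi> r \<tau> d (\<theta> (Suc k)) t)"
      "(LBINT t:{0..\<tau>}. (intensity \<psi> r \<tau> d (\<theta> k) t - intensity \<psi> r \<tau> d (\<theta> (Suc k)) t)\<^sup>2 / intensity \<psi> r \<tau> d (\<theta> (Suc k)) t)
        \<le> (r * u / d)\<^sup>2 * (u / p + d / r * ln ((p + r) / p))"
      unfolding pred[symmetric] using loc'
      by (intro intensity_chi_square_bound[where m = m and p = p] \<psi> m r d u p; simp)+
    have "real n * (LBINT t:{0..\<tau>}. (intensity \<psi> r \<tau> d (\<theta> k) t - intensity \<psi> r \<tau> d (\<theta> (Suc k)) t)\<^sup>2 / intensity \<psi> r \<tau> d (\<theta> (Suc k)) t) \<le> D"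
      using mult_left_mono[OF chi(2) of_nat_0_le_iff[of n]] D by linarith
    then show "\<bar>(\<integral>x. f x \<partial>sample_law (\<Omega> (\<theta> k)) \<tau> n (X (\<theta> k))) - (\<integral>x. f x \<partial>sample_law (\<Omega> (\<theta> (Suc k))) \<tau> n (X (\<theta> (Suc k))))\<bar>
        \<le> sqrt (exp D - 1) * sqrt (\<integral>x. (f x)\<^sup>2 \<partial>sample_law (\<Omega> (\<theta> (Suc k))) \<tau> n (X (\<theta> (Suc k))))"
      using k by (intro sample_law_expectation_diff[OF sample sample n \<tau> m(1) r_lb r_lb chi(1) _ f B]) auto
  qed (use S u R in \<open>simp_all add: sets_sample_law\<close>)
qed

lemma unscaled_risk_lower_bound:
  fixes a s \<phi> C :: real
  assumes "0 < \<phi>" "0 \<le> s" "a * \<phi> \<le> sqrt (s * \<phi>\<^sup>2) * C" "0 < C" "0 \<le> a"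
  shows "(a / C)\<^sup>2 \<le> s"
proof -
  have "sqrt (s * \<phi>\<^sup>2) = sqrt s * \<phi>" using assms by (simp add: real_sqrt_mult)
  with assms(3) have "a * \<phi> \<le> (sqrt s * C) * \<phi>" by (simp add: mult_ac)
  then have "a \<le> sqrt s * C" using \<open>0 < \<phi>\<close> by simp
  then have "a / C \<le> sqrt s" using \<open>0 < C\<close> by (simp add: divide_le_eq)
  then have "(a / C)\<^sup>2 \<le> (sqrt s)\<^sup>2" using assms by (intro power_mono) auto
  then show ?thesis using assms by simp
qed

lemma mono_tendsto_at_right_INF:
  fixes g :: "real \<Rightarrow> 'b::{complete_linorder, linorder_topology}"
  assumes "mono_on {a<..} g"
  shows "(g \<longlongrightarrow> (INF x\<in>{a<..}. g x)) (at_right a)"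
proof (rule order_tendstoI)
  fix y assume "y < (INF x\<in>{a<..}. g x)"
  then have "y < g x" if "a < x" for x
    using that by (meson INF_lower greaterThan_iff less_le_trans)
  then show "\<forall>\<^sub>F x in at_right a. y < g x"
    by (intro eventually_at_rightI[of a "a + 1"]) auto
next
  fix y assume "(INF x\<in>{a<..}. g x) < y"
  then obtain b where b: "a < b" "g b < y" by (auto simp: INF_less_iff)
  have "g x < y" if "x \<in> {a<..<b}" for x
    using mono_onD[OF assms, of x b] b that by (auto intro: le_less_trans)
  then show "\<forall>\<^sub>F x in at_right a. g x < y"
    using b by (intro eventually_at_rightI[of a b]) auto
qed

theorem theorem1:
  fixes \<alpha> \<beta> \<tau> r :: real
    and \<psi> F :: "real \<Rightarrow> real"
    and \<delta> \<phi> :: "nat \<Rightarrow> real"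
    and \<Omega> :: "nat \<Rightarrow> real \<Rightarrow> 'a measure"
    and X :: "nat \<Rightarrow> real \<Rightarrow> nat \<Rightarrow> 'a \<Rightarrow> real \<Rightarrow> nat"
    and P :: "nat \<Rightarrow> real \<Rightarrow> (nat \<Rightarrow> real \<Rightarrow> nat) measure"
  assumes "0 < \<alpha>" and "\<alpha> < \<beta>" and "\<beta> < \<tau>"
    and "continuous_on {0..\<tau>} \<psi>" and "\<And>t. t \<in> {0..\<tau>} \<Longrightarrow> 0 < \<psi> t"
    and "r > - (INF t\<in>{0..\<tau>}. \<psi> t)" and "r \<noteq> 0"
    and "\<And>n. n \<ge> 1 \<Longrightarrow> 0 < \<delta> n" and "antimono_on {1..} \<delta>" and "\<delta> \<longlonglongrightarrow> 0"
    and "\<And>n \<theta>. n \<ge> 1 \<Longrightarrow> \<theta> \<in> {\<alpha><..<\<beta>} \<Longrightarrow>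
           poisson_sample (\<Omega> n \<theta>) \<tau> (intensity \<psi> r \<tau> (\<delta> n) \<theta>) n (X n \<theta>)"
    and "filterlim (\<lambda>n. real n * \<delta> n) at_top sequentially"
  defines "P \<equiv> \<lambda>n \<theta>. sample_law (\<Omega> n \<theta>) \<tau> n (X n \<theta>)"
    and "\<phi> \<equiv> \<lambda>n. sqrt (\<delta> n / real n)"
    and "F \<equiv> \<lambda>\<theta>. r * ln ((\<psi> \<theta> + r) / \<psi> \<theta>)"
  shows "\<forall>\<theta>\<^sub>0\<in>{\<alpha><..<\<beta>}. \<exists>L::ennreal.
           ((\<lambda>\<epsilon>. liminf (\<lambda>n.
               INF T\<in>borel_measurable (sample_space \<tau> n).
                 SUP \<theta>\<in>{\<theta>. \<theta> \<in> {\<alpha><..<\<beta>} \<and> \<bar>\<theta> - \<theta>\<^sub>0\<bar> < \<epsilon>}.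
                   ennreal (1 / (\<phi> n)\<^sup>2) * quadratic_risk (P n \<theta>) \<theta> T)) \<longlongrightarrow> L) (at_right 0)
           \<and> ennreal (1 / F \<theta>\<^sub>0) \<le> L"
proof
  fix \<theta>\<^sub>0 assume "\<theta>\<^sub>0 \<in> {\<alpha><..<\<beta>}"
  then have \<theta>\<^sub>0: "\<alpha> < \<theta>\<^sub>0" "\<theta>\<^sub>0 < \<beta>" by auto
  note \<psi> = assms(4) and \<delta>_pos = assms(8) and sample = assms(11)
  have \<tau>: "0 < \<tau>" using assms(1-3) by linarith
  define V where "V n \<epsilon> = (INF T\<in>borel_measurable (sample_space \<tau> n).
      SUP \<theta>\<in>{\<theta>. \<theta> \<in> {\<alpha><..<\<beta>} \<and> \<bar>\<theta> - \<theta>\<^sub>0\<bar> < \<epsilon>}. ennreal (1 / (\<phi> n)\<^sup>2) * quadratic_risk (P n \<theta>) \<theta> T)" for n \<epsilon>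
  define G where "G \<epsilon> = liminf (\<lambda>n. V n \<epsilon>)" for \<epsilon>
  obtain t\<^sub>1 where t1: "t\<^sub>1 \<in> {0..\<tau>}" "\<And>t. t \<in> {0..\<tau>} \<Longrightarrow> \<psi> t\<^sub>1 \<le> \<psi> t"
    using continuous_attains_inf[OF compact_Icc _ \<psi>] \<tau> by auto
  have "(INF t\<in>{0..\<tau>}. \<psi> t) = \<psi> t\<^sub>1"
    using t1 by (intro cInf_eq_minimum) auto
  then have r1: "0 < \<psi> t\<^sub>1 + r" using assms(6) by simp
  define m where "m = min (\<psi> t\<^sub>1) (\<psi> t\<^sub>1 + r)"
  have m: "0 < m" "\<And>t. t \<in> {0..\<tau>} \<Longrightarrow> m \<le> \<psi> t" "\<And>t. t \<in> {0..\<tau>} \<Longrightarrow> m \<le> \<psi> t + r"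
    using r1 t1 assms(5)[of t\<^sub>1] by (auto simp: m_def) (smt (verit) atLeastAtMost_iff)+
  have \<theta>\<tau>: "\<theta>\<^sub>0 \<in> {0..\<tau>}" using \<theta>\<^sub>0 assms(1-3) by auto
  have \<psi>0: "0 < \<psi> \<theta>\<^sub>0" "0 < \<psi> \<theta>\<^sub>0 + r" using m(1) m(2,3)[OF \<theta>\<tau>] by auto
  have F0: "0 < F \<theta>\<^sub>0" unfolding F_def by (rule fisher_information_pos[OF \<psi>0 assms(7)])
  \<comment> \<open>\<open>h\<close> is the step of the progression in units of \<open>\<phi> n\<close>, and \<open>N\<close> its number of steps\<close>
  have key: "ennreal ((real N * h / (2 + real N * sqrt (exp (h\<^sup>2 * K) - 1)))\<^sup>2) \<le> G \<epsilon>"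
    if \<epsilon>: "0 < \<epsilon>" and K: "F \<theta>\<^sub>0 < K" and h: "0 < h" for \<epsilon> K h :: real and N
  proof -
    \<comment> \<open>\<open>p\<close> is a local lower bound of \<open>\<psi>\<close> that is still so close to \<open>\<psi> \<theta>\<^sub>0\<close> that the information stays below \<open>K\<close>\<close>
    have "((\<lambda>p. r * ln ((p + r) / p)) \<longlongrightarrow> r * ln ((\<psi> \<theta>\<^sub>0 + r) / \<psi> \<theta>\<^sub>0)) (at_left (\<psi> \<theta>\<^sub>0))"
      using \<psi>0 by (intro tendsto_intros) auto
    then have "\<forall>\<^sub>F p in at_left (\<psi> \<theta>\<^sub>0). r * ln ((p + r) / p) < K"
      using K by (intro order_tendstoD) (auto simp: F_def)
    moreover have "\<forall>\<^sub>F p in at_left (\<psi> \<theta>\<^sub>0). 0 < p \<and> 0 < p + r"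
      using \<psi>0 by (intro eventually_at_leftI[of "max 0 (- r)"]) auto
    moreover have "\<forall>\<^sub>F p in at_left (\<psi> \<theta>\<^sub>0). p < \<psi> \<theta>\<^sub>0"
      by (intro eventually_at_leftI[of "\<psi> \<theta>\<^sub>0 - 1"]) auto
    ultimately have "\<forall>\<^sub>F p in at_left (\<psi> \<theta>\<^sub>0). r * ln ((p + r) / p) < K \<and> (0 < p \<and> 0 < p + r) \<and> p < \<psi> \<theta>\<^sub>0"
      by eventually_elim auto
    then obtain p where p: "r * ln ((p + r) / p) < K" "0 < p" "0 < p + r" "p < \<psi> \<theta>\<^sub>0"
      using eventually_happens trivial_limit_at_left_real by blast
    obtain \<eta> where \<eta>: "0 < \<eta>" "\<And>t. t \<in> {0..\<tau>} \<Longrightarrow> dist t \<theta>\<^sub>0 < \<eta> \<Longrightarrow> dist (\<psi> t) (\<psi> \<theta>\<^sub>0) < \<psi> \<theta>\<^sub>0 - p"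
      using \<psi> \<theta>\<tau> p(4) unfolding continuous_on_iff by (metis diff_gt_0_iff_gt)
    have loc: "p \<le> \<psi> t" if "t \<in> {0..\<tau>}" "\<bar>t - \<theta>\<^sub>0\<bar> < \<eta>" for t
      using \<eta>(2)[OF that(1)] that(2) by (auto simp: dist_real_def)
    define u where "u n = h * \<phi> n" for n
    have "(\<lambda>n. \<delta> n * (1 / real n)) \<longlonglongrightarrow> 0 * 0"
      by (intro tendsto_mult assms(10) lim_1_over_n)
    then have \<phi>0: "\<phi> \<longlonglongrightarrow> 0"
      unfolding \<phi>_def using tendsto_real_sqrt by fastforce
    have ev1: "\<forall>\<^sub>F n in sequentially. real N * u n + \<delta> n < Min {\<eta>, \<epsilon>, \<beta> - \<theta>\<^sub>0}"
    proof (rule order_tendstoD)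
      have "(\<lambda>n. real N * (h * \<phi> n) + \<delta> n) \<longlonglongrightarrow> real N * (h * 0) + 0"
        by (intro tendsto_intros \<phi>0 assms(10))
      then show "(\<lambda>n. real N * u n + \<delta> n) \<longlonglongrightarrow> 0" by (simp add: u_def)
    qed (use \<eta> \<epsilon> \<theta>\<^sub>0 in auto)
    \<comment> \<open>the scaling \<open>n * (u n)\<^sup>2 / \<delta> n = h\<^sup>2\<close> turns \<open>n\<close> times the chi-square bound into the left-hand side; \<open>n * \<delta> n \<longlonglongrightarrow> \<infinity>\<close> removes its first term\<close>
    have ev2: "\<forall>\<^sub>F n in sequentially. h\<^sup>2 * (r\<^sup>2 * (u n / \<delta> n) / p + r * ln ((p + r) / p)) < h\<^sup>2 * K"
    proof (rule order_tendstoD)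
      have "(\<lambda>n. 1 / sqrt (real n * \<delta> n)) \<longlonglongrightarrow> 0"
        using filterlim_compose[OF sqrt_at_top assms(12)] by (intro tendsto_divide_0[OF tendsto_const]) (rule filterlim_at_top_imp_at_infinity)
      then have "(\<lambda>n. h * (1 / sqrt (real n * \<delta> n))) \<longlonglongrightarrow> h * 0"
        by (intro tendsto_intros)
      moreover have "\<forall>\<^sub>F n in sequentially. h * (1 / sqrt (real n * \<delta> n)) = u n / \<delta> n"
        using eventually_ge_at_top[of 1]
      proof eventually_elim
        case (elim n)
        then have "0 < \<delta> n" "0 < real n" using \<delta>_pos by auto
        then have "sqrt (\<delta> n) * sqrt (\<delta> n) = \<delta> n" by simp
        then show ?case using \<open>0 < \<delta> n\<close> \<open>0 < real n\<close>
          by (simp add: u_def \<phi>_def real_sqrt_divide real_sqrt_mult field_simps)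
      qed
      ultimately have "(\<lambda>n. u n / \<delta> n) \<longlonglongrightarrow> h * 0" by (rule Lim_transform_eventually)
      then have "(\<lambda>n. h\<^sup>2 * (r\<^sup>2 * (u n / \<delta> n) / p + r * ln ((p + r) / p))) \<longlonglongrightarrow>
          h\<^sup>2 * (r\<^sup>2 * (h * 0) / p + r * ln ((p + r) / p))"
        using p by (intro tendsto_intros) auto
      then show "(\<lambda>n. h\<^sup>2 * (r\<^sup>2 * (u n / \<delta> n) / p + r * ln ((p + r) / p))) \<longlonglongrightarrow> h\<^sup>2 * (r * ln ((p + r) / p))"
        by simp
    qed (use p h in simp)
    define C where "C = 2 + real N * sqrt (exp (h\<^sup>2 * K) - 1)"
    have "\<forall>\<^sub>F n in sequentially. ennreal ((real N * h / C)\<^sup>2) \<le> V n \<epsilon>"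
      using ev1 ev2 eventually_ge_at_top[of 1]
    proof eventually_elim
      case (elim n)
      have d: "0 < \<delta> n" using \<delta>_pos elim by simp
      then have \<phi>n: "0 < \<phi> n" using elim by (simp add: \<phi>_def)
      have un: "0 < u n" using h \<phi>n by (simp add: u_def)
      have u2: "real n * (u n)\<^sup>2 = h\<^sup>2 * \<delta> n"
        using elim d by (simp add: u_def \<phi>_def power_mult_distrib)
      have "real n * ((r * u n / \<delta> n)\<^sup>2 * (u n / p + \<delta> n / r * ln ((p + r) / p))) =
          (real n * (u n)\<^sup>2) * (r\<^sup>2 / (\<delta> n)\<^sup>2 * (u n / p + \<delta> n / r * ln ((p + r) / p)))"
        by (simp add: power_mult_distrib power_divide)
      also have "\<dots> = h\<^sup>2 * (r\<^sup>2 * (u n / \<delta> n) / p + r * ln ((p + r) / p))"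
        unfolding u2 using d assms(7) p by (simp add: field_simps power2_eq_square)
      finally have D: "real n * ((r * u n / \<delta> n)\<^sup>2 * (u n / p + \<delta> n / r * ln ((p + r) / p))) \<le> h\<^sup>2 * K"
        using elim by simp
      have small: "real N * u n + \<delta> n < \<eta>" "real N * u n < \<epsilon>" "real N * u n < \<beta> - \<theta>\<^sub>0"
        using elim d by auto
      have le_N: "0 \<le> real k * u n" "real k * u n \<le> real N * u n" if "k \<le> N" for k
        using that un by (auto intro: mult_right_mono)
      have in_\<Theta>: "\<theta>\<^sub>0 + real k * u n \<in> {\<alpha><..<\<beta>}" "\<bar>(\<theta>\<^sub>0 + real k * u n) - \<theta>\<^sub>0\<bar> < \<epsilon>" if "k \<le> N" for k
        using le_N[OF that] small \<theta>\<^sub>0 by auto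
      have C: "0 < C"
      proof -
        have "0 \<le> h\<^sup>2 * K" using K F0 by simp
        then show ?thesis unfolding C_def by (intro add_pos_nonneg mult_nonneg_nonneg) auto
      qed
      show ?case unfolding V_def
      proof (rule INF_greatest)
        fix T :: "(nat \<Rightarrow> real \<Rightarrow> nat) \<Rightarrow> real"
        assume T: "T \<in> borel_measurable (sample_space \<tau> n)"
        let ?s = "SUP \<theta>\<in>{\<theta>. \<theta> \<in> {\<alpha><..<\<beta>} \<and> \<bar>\<theta> - \<theta>\<^sub>0\<bar> < \<epsilon>}. ennreal (1 / (\<phi> n)\<^sup>2) * quadratic_risk (P n \<theta>) \<theta> T"
        show "ennreal ((real N * h / C)\<^sup>2) \<le> ?s"
        proof (cases ?s)
          case top
          show ?thesis unfolding top by (rule top_greatest)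
        next
          case (real s)
          have "real N * u n \<le> sqrt (s * (\<phi> n)\<^sup>2) * (2 + real N * sqrt (exp (h\<^sup>2 * K) - 1))"
          proof (rule risk_bound_along_progression[where \<Omega>="\<Omega> n" and X="X n" and \<theta>\<^sub>0=\<theta>\<^sub>0 and S=T and n=n and \<tau>=\<tau>,
                OF _ \<tau> \<psi> m assms(7) d _ p(2,3) _ _ D T])
            show "1 \<le> n" "0 \<le> u n" "0 \<le> s * (\<phi> n)\<^sup>2" using elim un real by auto
            fix k assume k: "k \<le> N"
            show "poisson_sample (\<Omega> n (\<theta>\<^sub>0 + real k * u n)) \<tau> (intensity \<psi> r \<tau> (\<delta> n) (\<theta>\<^sub>0 + real k * u n)) n (X n (\<theta>\<^sub>0 + real k * u n))"
              using elim by (intro sample in_\<Theta>(1)[OF k])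
            let ?\<theta> = "\<theta>\<^sub>0 + real k * u n"
            have "ennreal (1 / (\<phi> n)\<^sup>2) * quadratic_risk (P n ?\<theta>) ?\<theta> T \<le> ennreal s"
              unfolding real(2)[symmetric] using in_\<Theta>[OF k] by (intro SUP_upper) auto
            then have "ennreal ((\<phi> n)\<^sup>2) * (ennreal (1 / (\<phi> n)\<^sup>2) * quadratic_risk (P n ?\<theta>) ?\<theta> T) \<le> ennreal ((\<phi> n)\<^sup>2) * ennreal s"
              by (rule mult_left_mono) simp
            moreover have "ennreal ((\<phi> n)\<^sup>2) * (ennreal (1 / (\<phi> n)\<^sup>2) * x) = x" for x
              using \<phi>n by (simp add: mult.assoc[symmetric] flip: ennreal_mult)
            ultimately show "quadratic_risk (sample_law (\<Omega> n ?\<theta>) \<tau> n (X n ?\<theta>)) ?\<theta> T \<le> ennreal (s * (\<phi> n)\<^sup>2)"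
              using real by (simp add: P_def ennreal_mult mult.commute)
          next
            fix t assume "t \<in> {\<theta>\<^sub>0..\<theta>\<^sub>0 + real N * u n + \<delta> n}" "t \<in> {0..\<tau>}"
            then show "p \<le> \<psi> t" using small by (intro loc) auto
          qed
          then have "(real N * h) * \<phi> n \<le> sqrt (s * (\<phi> n)\<^sup>2) * C"
            by (simp add: u_def C_def mult.assoc)
          then have "(real N * h / C)\<^sup>2 \<le> s"
            using \<phi>n real C h by (intro unscaled_risk_lower_bound[of "\<phi> n"]) auto
          then show ?thesis unfolding real(2) by (rule ennreal_leI)
        qed
      qed
    qed
    then show ?thesis unfolding G_def C_def by (rule Liminf_bounded)
  qed
  have G_ge: "ennreal (1 / F \<theta>\<^sub>0) \<le> G \<epsilon>" if \<epsilon>: "0 < \<epsilon>" for \<epsilon>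
  proof -
    have K_ge: "ennreal (1 / K) \<le> G \<epsilon>" if K: "F \<theta>\<^sub>0 < K" for K
    proof (rule LIMSEQ_le_const2)
      have "0 < K" using K F0 by linarith
      from bias_bound_limit[OF this] show "(\<lambda>i. ennreal ((real ((Suc i)\<^sup>2) * (1 / real (Suc i)) /
          (2 + real ((Suc i)\<^sup>2) * sqrt (exp ((1 / real (Suc i))\<^sup>2 * K) - 1)))\<^sup>2)) \<longlonglongrightarrow> ennreal (1 / K)"
        by (intro tendsto_ennrealI) (simp only: of_nat_power)
      show "\<exists>N. \<forall>i\<ge>N. ennreal ((real ((Suc i)\<^sup>2) * (1 / real (Suc i)) /
          (2 + real ((Suc i)\<^sup>2) * sqrt (exp ((1 / real (Suc i))\<^sup>2 * K) - 1)))\<^sup>2) \<le> G \<epsilon>"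
        by (intro exI allI impI key \<epsilon> K) simp
    qed
    have "((\<lambda>K. ennreal (1 / K)) \<longlongrightarrow> ennreal (1 / F \<theta>\<^sub>0)) (at_right (F \<theta>\<^sub>0))"
      using F0 by (intro tendsto_ennrealI tendsto_intros) auto
    then show ?thesis
      by (rule tendsto_upperbound) (auto intro!: eventually_at_rightI[of "F \<theta>\<^sub>0" "F \<theta>\<^sub>0 + 1"] K_ge)
  qed
  \<comment> \<open>a larger \<open>\<epsilon>\<close> enlarges the range of the supremum, so the limit at \<open>0\<close> exists and is an infimum\<close>
  have "mono_on {0<..} G"
    unfolding G_def V_def
    by (intro mono_onI Liminf_mono always_eventually allI INF_mono) (auto intro!: bexI SUP_subset_mono)
  then have "(G \<longlongrightarrow> (INF x\<in>{0<..}. G x)) (at_right 0)"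
    by (rule mono_tendsto_at_right_INF)
  moreover have "ennreal (1 / F \<theta>\<^sub>0) \<le> (INF x\<in>{0<..}. G x)"
    using G_ge by (intro INF_greatest) auto
  ultimately show "\<exists>L::ennreal.
           ((\<lambda>\<epsilon>. liminf (\<lambda>n.
               INF T\<in>borel_measurable (sample_space \<tau> n).
                 SUP \<theta>\<in>{\<theta>. \<theta> \<in> {\<alpha><..<\<beta>} \<and> \<bar>\<theta> - \<theta>\<^sub>0\<bar> < \<epsilon>}.
                   ennreal (1 / (\<phi> n)\<^sup>2) * quadratic_risk (P n \<theta>) \<theta> T)) \<longlongrightarrow> L) (at_right 0)
           \<and> ennreal (1 / F \<theta>\<^sub>0) \<le> L"
    unfolding G_def[abs_def] V_def by blast
qed

end
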